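(* Let $B$ be a skew brace of abelian type, i.e. a skew brace whose additive group $(B,+)$ is abelian. Then: \begin{enumerate} \item If $|B/\operatorname{Z}(B)|=t$ is finite, then $[B,B]^B$ is finite and $|[B,B]^B|\leq \omega(t^2)$. \item If $[B,B]^B\subseteq\ker\lambda$ and $|B/\operatorname{Z}_n(B)|=t$ is finite for some integer $n\ge1$, then $\Gamma_{n+1}(B)$ is finite and $|\Gamma_{n+1}(B)|\leq \omega(t^2)^{t^{n-1}}$. \end{enumerate}
   Context: For an integer $s>1$ with smallest prime divisor $p$, $\omega(s)=s^{m}$ with $m=(\log_p(s)-1)/2$; also $\omega(1)=1$. A skew (left) brace $(B,+,\cdot)$ is a set $B$ with two group structures $(B,+)$ and $(B,\cdot)$ such that $a(b+c)=ab-a+ac$ for all $a,b,c\in B$; the two groups share the identity element $0$. Put $a*b=-a+ab-b$ and $\lambda_a(b)=-a+ab$; $a\mapsto\lambda_a$ is a homomorphism $(B,\cdot)\to\operatorname{Aut}(B,+)$. For $X,Y\subseteq B$, $X*Y$ is the subgroup of $(B,+)$ generated by $\{x*y\mid x\in X,y\in Y\}$, and $[X,Y]_+$, $[X,Y]_\bullet$ are the commutator subgroups of $X$ and $Y$ in $(B,+)$ and $(B,\cdot)$, respectively. A subbrace is a subset that is a subgroup of both $(B,+)$ and $(B,\cdot)$. An ideal is a subbrace $I$ with $(I,+)$ normal in $(B,+)$, $B*I\subseteq I$ and $I*B\subseteq I$; then the quotient skew brace $B/I$ is defined. $\langle X\rangle^B$ is the smallest ideal of $B$ containing $X$. For ideals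 $I,J$, $[I,J]^B=\langle [I,J]_+\cup[I,J]_\bullet\cup\{ij-(i+j)\mid i\in I,j\in J\}\rangle^B$; the derived ideal of $B$ is $[B,B]^B$. The lower central series is $\Gamma_1(B)=B$, $\Gamma_{n+1}(B)=[\Gamma_n(B),B]^B$ for $n\ge1$. $\ker\lambda=\{a\in B\mid \lambda_a(b)=b\ \forall b\in B\}$, and the centre is the ideal $\operatorname{Z}(B)=\ker\lambda\cap \operatorname{Z}(B,+)\cap \operatorname{Z}(B,\cdot)$, where $\operatorname{Z}(B,+)$ and $\operatorname{Z}(B,\cdot)$ are the centres of the two groups. The upper central series is $\operatorname{Z}_0(B)=0$, $\operatorname{Z}_{n+1}(B)/\operatorname{Z}_n(B)=\operatorname{Z}(B/\operatorname{Z}_n(B))$. *)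

theory Defs
  imports
    Complex_Main
    "HOL-Computational_Algebra.Primes"
    "HOL-Algebra.QuotRing"
    "HOL-Algebra.Generated_Groups"
begin

text \<open>
  Skew braces live on the ring record of HOL-Algebra, but the multiplication is now a group
  operation, the additive group need not be abelian, and the two distributive laws are replaced by
  the skew one. The identities \<open>\<one>\<close> and \<open>\<zero>\<close> coincide as a consequence: put
  \<open>b = c = \<zero>\<close> in the skew distributive law.
\<close>

locale skew_brace =
  fixes B :: "('a, 'm) ring_scheme" (structure)
  assumes add_group: "group (add_monoid B)"
    and mult_group: "group B"
    and skew_distrib: "\<lbrakk>a \<in> carrier B; b \<in> carrier B; c \<in> carrier B\<rbrakk>
      \<Longrightarrow> a \<otimes> (b \<oplus> c) = (a \<otimes> b) \<oplus> (\<ominus> a) \<oplus> (a \<otimes> c)"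

locale skew_brace_abelian_type = skew_brace +
  assumes add_comm_group: "comm_group (add_monoid B)"

definition brace_star :: "('a, 'm) ring_scheme \<Rightarrow> 'a \<Rightarrow> 'a \<Rightarrow> 'a"
  where "brace_star B a b = (\<ominus>\<^bsub>B\<^esub> a) \<oplus>\<^bsub>B\<^esub> (a \<otimes>\<^bsub>B\<^esub> b) \<oplus>\<^bsub>B\<^esub> (\<ominus>\<^bsub>B\<^esub> b)"

definition brace_lambda :: "('a, 'm) ring_scheme \<Rightarrow> 'a \<Rightarrow> 'a \<Rightarrow> 'a"
  where "brace_lambda B a b = (\<ominus>\<^bsub>B\<^esub> a) \<oplus>\<^bsub>B\<^esub> (a \<otimes>\<^bsub>B\<^esub> b)"

definition brace_star_set :: "('a, 'm) ring_scheme \<Rightarrow> 'a set \<Rightarrow> 'a set \<Rightarrow> 'a set"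
  where "brace_star_set B X Y =
    generate (add_monoid B) {brace_star B x y | x y. x \<in> X \<and> y \<in> Y}"

definition commutator_subgroup :: "('a, 'm) monoid_scheme \<Rightarrow> 'a set \<Rightarrow> 'a set \<Rightarrow> 'a set"
  where "commutator_subgroup G X Y =
    generate G {x \<otimes>\<^bsub>G\<^esub> y \<otimes>\<^bsub>G\<^esub> inv\<^bsub>G\<^esub> x \<otimes>\<^bsub>G\<^esub> inv\<^bsub>G\<^esub> y | x y. x \<in> X \<and> y \<in> Y}"

definition subbrace :: "'a set \<Rightarrow> ('a, 'm) ring_scheme \<Rightarrow> bool"
  where "subbrace S B \<longleftrightarrow> subgroup S (add_monoid B) \<and> subgroup S B"

definition brace_ideal :: "'a set \<Rightarrow> ('a, 'm) ring_scheme \<Rightarrow> bool"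
  where "brace_ideal I B \<longleftrightarrow>
    subbrace I B \<and> normal I (add_monoid B) \<and>
    brace_star_set B (carrier B) I \<subseteq> I \<and> brace_star_set B I (carrier B) \<subseteq> I"

definition brace_ideal_gen :: "('a, 'm) ring_scheme \<Rightarrow> 'a set \<Rightarrow> 'a set"
  where "brace_ideal_gen B X = \<Inter> {I. brace_ideal I B \<and> X \<subseteq> I}"

definition brace_commutator :: "('a, 'm) ring_scheme \<Rightarrow> 'a set \<Rightarrow> 'a set \<Rightarrow> 'a set"
  where "brace_commutator B I J = brace_ideal_gen B
    (commutator_subgroup (add_monoid B) I J \<union> commutator_subgroup B I J \<union>
      {(i \<otimes>\<^bsub>B\<^esub> j) \<ominus>\<^bsub>B\<^esub> (i \<oplus>\<^bsub>B\<^esub> j) | i j. i \<in> I \<and> j \<in> J})"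

abbreviation derived_ideal :: "('a, 'm) ring_scheme \<Rightarrow> 'a set"
  where "derived_ideal B \<equiv> brace_commutator B (carrier B) (carrier B)"

text \<open>The series starts at index 1; the value at index 0 is a dummy.\<close>

fun brace_lower_central :: "('a, 'm) ring_scheme \<Rightarrow> nat \<Rightarrow> 'a set" where
  "brace_lower_central B 0 = carrier B"
| "brace_lower_central B (Suc 0) = carrier B"
| "brace_lower_central B (Suc (Suc n)) =
    brace_commutator B (brace_lower_central B (Suc n)) (carrier B)"

definition brace_lambda_ker :: "('a, 'm) ring_scheme \<Rightarrow> 'a set"
  where "brace_lambda_ker B =
    {a \<in> carrier B. \<forall>b \<in> carrier B. brace_lambda B a b = b}"

definition group_centre :: "('a, 'm) monoid_scheme \<Rightarrow> 'a set"
  where "group_centre G = {z \<in> carrier G. \<forall>g \<in> carrier G. z \<otimes>\<^bsub>G\<^esub> g = g \<otimes>\<^bsub>G\<^esub> z}"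

definition brace_centre :: "('a, 'm) ring_scheme \<Rightarrow> 'a set"
  where "brace_centre B =
    brace_lambda_ker B \<inter> group_centre (add_monoid B) \<inter> group_centre B"

text \<open>
  For an ideal \<open>I\<close>, the quotient skew brace is \<^term>\<open>B Quot I\<close>: its elements are the additive cosets
  of \<open>I\<close> (which are also the multiplicative ones), added by \<^const>\<open>set_add\<close>. The product of two cosets
  under \<^const>\<open>rcoset_mult\<close> is the union of the cosets of all products of representatives; for an
  ideal of a skew brace these all coincide, exactly as for an ideal of a ring.

  The next term of the upper central series is the full preimage in \<open>B\<close> of the centre of the quotient.
\<close>

primrec brace_upper_central :: "('a, 'm) ring_scheme \<Rightarrow> nat \<Rightarrow> 'a set" where
  "brace_upper_central B 0 = {\<zero>\<^bsub>B\<^esub>}"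
| "brace_upper_central B (Suc n) =
    {b \<in> carrier B. brace_upper_central B n +>\<^bsub>B\<^esub> b
        \<in> brace_centre (B Quot brace_upper_central B n)}"

text \<open>The value at 0 is a dummy.\<close>

definition omega :: "nat \<Rightarrow> real"
  where "omega s = (if s \<le> 1 then 1
    else real s powr ((log (real (LEAST p. prime p \<and> p dvd s)) (real s) - 1) / 2))"

end

theory Submission
  imports Defs
begin

text \<open>
  Write \<open>a \<star> b\<close> for \<^const>\<open>brace_star\<close>, so that \<open>\<lambda>\<^sub>a b = b + a \<star> b\<close>. When \<open>(B,+)\<close> is abelian, \<open>\<star>\<close> is additive on
  the right and measures the whole difference between the two group structures:
  \<open>a \<cdot> b = a + b + a \<star> b\<close>. Commutators in \<open>(B,\<cdot>)\<close> then lie in the ideal generated by the products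
  \<open>a \<star> b\<close>, so the lower central series is bounded above by the groups \<open>L\<^sub>0 = B\<close>, \<open>L\<^sub>k\<^sub>+\<^sub>1 = B * L\<^sub>k\<close>; for
  \<open>k \<ge> 2\<close> this uses that the derived ideal acts trivially. In terms of the action of \<open>(B,\<cdot>)\<close> on
  \<open>(B,+)\<close>, the group \<open>L\<^sub>k\<close> is the \<open>k\<close>-th power of the augmentation ideal applied to \<open>(B,+)\<close>.
  
  The bound rests on the fact that an augmentation ideal is generated by the elements \<open>x - 1\<close> with \<open>x\<close>
  in a generating set of the group. Let \<open>t > 1\<close> be the order of \<open>B/Z\<^sub>n(B)\<close> and \<open>p\<close> its smallest prime
  divisor. Each new generator multiplies the order of a subgroup by at least \<open>p\<close>, so
  \<open>(B,\<cdot>)\<close> is generated modulo \<open>Z\<^sub>n\<close> by a set \<open>X\<close> of \<open>d\<close> elements with \<open>p\<^sup>d \<le> t\<close>. If \<open>L\<^sub>k\<close> is covered by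
  \<open>N\<close> cosets of \<open>Z\<^sub>n\<^sub>-\<^sub>k\<close>, then every element of \<open>L\<^sub>k\<^sub>+\<^sub>1\<close> is, modulo \<open>Z\<^sub>n\<^sub>-\<^sub>k\<^sub>-\<^sub>1\<close>, a sum of terms \<open>x \<star> m\<^sub>x\<close> with
  one \<open>m\<^sub>x \<in> L\<^sub>k\<close> for each \<open>x \<in> X\<close>, and only the coset of \<open>m\<^sub>x\<close> matters; hence \<open>N\<^sup>d\<close> cosets of
  \<open>Z\<^sub>n\<^sub>-\<^sub>k\<^sub>-\<^sub>1\<close> cover \<open>L\<^sub>k\<^sub>+\<^sub>1\<close> (lemma \<open>cover_star_set\<close>). Generators of \<open>(B,\<cdot>)\<close> taken from \<open>Z\<^sub>n\<close> contribute
  nothing, since \<open>Z\<^sub>n * L\<^sub>k \<subseteq> Z\<^sub>n\<^sub>-\<^sub>k\<^sub>-\<^sub>1\<close>: this is immediate for \<open>k = 0\<close>, and for larger \<open>k\<close> it holds because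
  the \<open>\<lambda>\<^sub>a\<close> commute when the derived ideal lies in \<open>ker \<lambda>\<close>. Starting from the \<open>t\<close> cosets of \<open>Z\<^sub>n\<close> in \<open>B\<close> and
  arriving at \<open>Z\<^sub>0 = 0\<close>, one gets \<open>|L\<^sub>n| \<le> t\<close> to the power \<open>d\<^sup>n\<close> (lemma \<open>star_power_cover\<close>). As
  \<open>d \<le> log\<^sub>p t\<close> and \<open>d \<le> t\<close>, this is at most \<open>\<omega>(t\<^sup>2)\<close> to the power \<open>t\<^sup>n\<^sup>-\<^sup>1\<close>, where
  \<open>\<omega>(t\<^sup>2)\<close> is \<open>t\<close> to the power \<open>2 log\<^sub>p t - 1\<close>. The first claim is the case \<open>n = 1\<close>, where
  only \<open>L\<^sub>0\<close> and \<open>L\<^sub>1\<close> occur.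
\<close>

section \<open>Small generating sets of finite groups\<close>

text \<open>
  By Lagrange the index of \<open>H\<close> in \<open>K\<close> is a divisor of the group order other than 1, hence at least the
  smallest prime divisor of that order.
\<close>

lemma (in group) card_subgroup_mult_le:
  assumes fin: "finite (carrier G)" and H: "subgroup H G" and K: "subgroup K G" and HK: "H \<subset> K"
    and p: "\<And>q. prime q \<Longrightarrow> q dvd order G \<Longrightarrow> p \<le> q"
  shows "p * card H \<le> card K"
proof -
  interpret K: group "G\<lparr>carrier := K\<rparr>" using K by (rule subgroup_imp_group)
  have Ksub: "K \<subseteq> carrier G" using K by (rule subgroup.subset)
  have finK: "finite K" using Ksub fin by (rule finite_subset)
  have "subgroup H (G\<lparr>carrier := K\<rparr>)"
    using H K HK by (intro subgroup_incl) auto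
  then have "card (rcosets\<^bsub>G\<lparr>carrier := K\<rparr>\<^esub> H) * card H = order (G\<lparr>carrier := K\<rparr>)"
    by (rule K.lagrange)
  then have eq: "card (rcosets\<^bsub>G\<lparr>carrier := K\<rparr>\<^esub> H) * card H = card K"
    by (simp add: order_def)
  define m where "m = card (rcosets\<^bsub>G\<lparr>carrier := K\<rparr>\<^esub> H)"
  have "card H < card K" using HK finK by (rule psubset_card_mono[rotated])
  then have "m \<noteq> 1" using eq by (auto simp: m_def)
  then obtain q where q: "prime q" "q dvd m" using prime_factor_nat by blast
  have "card K dvd order G" using lagrange[OF K] by (metis dvd_triv_right)
  then have "q dvd order G" using q(2) eq unfolding m_def by (metis dvd_trans dvd_triv_left)
  then have "p \<le> q" using p q(1) by blast
  also have "q \<le> m"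
    using q(2) \<open>card H < card K\<close> eq unfolding m_def[symmetric]
    by (metis dvd_imp_le gr_zeroI less_nat_zero_code mult_0)
  finally show ?thesis using eq unfolding m_def[symmetric] by (metis mult_le_mono1)
qed

text \<open>
  Among the sets \<open>X\<close> that satisfy \<open>p ^ card X \<le> |\<langle>X\<rangle>|\<close>, one of maximal cardinality generates \<open>G\<close>: adding an
  element outside \<open>\<langle>X\<rangle>\<close> would give a larger one.
\<close>

lemma (in group) exists_small_generating_set:
  assumes fin: "finite (carrier G)"
    and p: "\<And>q. prime q \<Longrightarrow> q dvd order G \<Longrightarrow> p \<le> q" and p0: "p > 1"
  shows "\<exists>X. X \<subseteq> carrier G \<and> p ^ card X \<le> order G \<and> generate G X = carrier G"
proof -
  define P where "P X \<longleftrightarrow> X \<subseteq> carrier G \<and> p ^ card X \<le> card (generate G X)" for X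
  have bound: "card X \<le> card (carrier G)" if "P X" for X
    using that fin by (auto simp: P_def intro: card_mono)
  have "P {}" by (simp add: P_def generate_empty)
  then obtain X where X: "P X" and max: "\<And>Y. P Y \<Longrightarrow> card Y \<le> card X"
    using ex_has_greatest_nat[of P "{}" card "Suc (card (carrier G))"] bound by (auto simp: less_Suc_eq_le)
  have Xc: "X \<subseteq> carrier G" and Xp: "p ^ card X \<le> card (generate G X)" using X by (auto simp: P_def)
  have finX: "finite X" using Xc fin by (rule finite_subset)
  have sub: "subgroup (generate G Y) G" if "Y \<subseteq> carrier G" for Y
    using that by (rule generate_is_subgroup)
  have "generate G X = carrier G"
  proof (rule ccontr)
    assume "generate G X \<noteq> carrier G"
    then obtain g where g: "g \<in> carrier G" "g \<notin> generate G X"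
      using subgroup.subset[OF sub[OF Xc]] by blast
    then have gX: "g \<notin> X" using generate.incl[of g X G] by blast
    have "generate G X \<subseteq> generate G (insert g X)" by (rule mono_generate) auto
    moreover have "g \<in> generate G (insert g X)" by (rule generate.incl) simp
    ultimately have "generate G X \<subset> generate G (insert g X)" using g by auto
    then have "p * card (generate G X) \<le> card (generate G (insert g X))"
      using Xc g by (intro card_subgroup_mult_le[OF fin sub sub _ p]) auto
    then have "p ^ card (insert g X) \<le> card (generate G (insert g X))"
      using Xp gX finX by (simp add: le_trans[OF mult_le_mono2])
    then have "P (insert g X)" using Xc g by (simp add: P_def)
    then have "card (insert g X) \<le> card X" by (rule max)
    then show False using gX finX by simp
  qed
  then show ?thesis using Xc Xp by (auto simp: order_def)
qed

text \<open>
  Generation modulo \<open>N\<close> is expressed by quantifying over the subgroups that contain \<open>N\<close> and \<open>X\<close>, which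
  is the form in which a set of elements with a good action property is shown to be everything.
\<close>

lemma (in group) exists_small_generating_set_mod:
  assumes N: "N \<lhd> G" and fin: "finite (carrier (G Mod N))"
    and p: "\<And>q. prime q \<Longrightarrow> q dvd order (G Mod N) \<Longrightarrow> p \<le> q" and p0: "p > 1"
  shows "\<exists>X. finite X \<and> X \<subseteq> carrier G \<and> p ^ card X \<le> order (G Mod N) \<and>
    (\<forall>H. subgroup H G \<longrightarrow> N \<subseteq> H \<longrightarrow> X \<subseteq> H \<longrightarrow> H = carrier G)"
proof -
  interpret N: normal N G by (rule N)
  interpret Q: group "G Mod N" by (rule N.factorgroup_is_group)
  obtain Y where Y: "Y \<subseteq> carrier (G Mod N)" "p ^ card Y \<le> order (G Mod N)"
      "generate (G Mod N) Y = carrier (G Mod N)"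
    using Q.exists_small_generating_set[OF fin p p0] by blast
  have hom: "group_hom G (G Mod N) (\<lambda>a. N #> a)"
    by (intro group_hom.intro group_hom_axioms.intro N.r_coset_hom_Mod) unfold_locales
  have "\<forall>y\<in>Y. \<exists>x\<in>carrier G. y = N #> x"
    using Y(1) by (auto simp: FactGroup_def RCOSETS_def)
  then obtain f where f: "\<And>y. y \<in> Y \<Longrightarrow> f y \<in> carrier G \<and> y = N #> f y" by metis
  have finY: "finite Y" using Y(1) fin by (rule finite_subset)
  have "H = carrier G" if H: "subgroup H G" and NH: "N \<subseteq> H" and XH: "f ` Y \<subseteq> H" for H
  proof
    show "H \<subseteq> carrier G" using H by (rule subgroup.subset)
    have "subgroup ((\<lambda>a. N #> a) ` H) (G Mod N)"
      using group_hom.subgroup_img_is_subgroup[OF hom H] .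
    moreover have "Y \<subseteq> (\<lambda>a. N #> a) ` H" using f XH by blast
    ultimately have "generate (G Mod N) Y \<subseteq> (\<lambda>a. N #> a) ` H"
      by (intro Q.generate_subgroup_incl)
    then have img: "carrier (G Mod N) \<subseteq> (\<lambda>a. N #> a) ` H" using Y(3) by simp
    show "carrier G \<subseteq> H"
    proof
      fix g assume g: "g \<in> carrier G"
      then have "N #> g \<in> carrier (G Mod N)" by (auto simp: FactGroup_def RCOSETS_def)
      then obtain h where h: "h \<in> H" "N #> g = N #> h" using img by blast
      have "g \<in> N #> g" using g N.subgroup_axioms by (rule rcos_self)
      then obtain n where "n \<in> N" "g = n \<otimes> h" using h by (auto simp: r_coset_def)
      then show "g \<in> H" using NH h H by (auto intro: subgroup.m_closed)
    qed
  qed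
  moreover have "p ^ card (f ` Y) \<le> order (G Mod N)"
    using Y(2) power_increasing[OF card_image_le[OF finY, of f], of p] p0 by linarith
  ultimately show ?thesis using f finY by (intro exI[of _ "f ` Y"]) auto
qed

section \<open>The function \<open>\<omega>\<close> at a square\<close>

text \<open>
  With \<open>l = log\<^sub>q t\<close> the right-hand side is \<open>t\<close> to the power \<open>(2l - 1) t\<^sup>n\<^sup>-\<^sup>1\<close>, because \<open>t\<^sup>2\<close> and \<open>t\<close> have the
  same smallest prime divisor. The hypothesis gives \<open>d \<le> l\<close> and \<open>d \<le> t\<close>, and \<open>l \<ge> 1\<close> gives \<open>l \<le> 2l - 1\<close>.
\<close>

lemma omega_square_ge:
  assumes t: "t > 1" and q: "q = (LEAST p. prime p \<and> p dvd t)"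
    and d: "q ^ d \<le> t" and n: "n \<ge> 1"
  shows "real (t ^ (d ^ n)) \<le> omega (t\<^sup>2) ^ (t ^ (n - 1))"
proof -
  have "\<exists>p. prime p \<and> p dvd t" using t prime_factor_nat[of t] by auto
  then have qp: "prime q" and qt: "q dvd t" using LeastI_ex[of "\<lambda>p. prime p \<and> p dvd t"] q by auto
  have q1: "q > 1" using qp by (rule prime_gt_1_nat)
  define l where "l = log q t"
  have lt: "real t = real q powr l" using t q1 by (simp add: l_def)
  have "q \<le> t" using qt t by (intro dvd_imp_le) auto
  then have l1: "l \<ge> 1" using t q1 by (simp add: l_def)
  have "real (q ^ d) \<le> real t" using d by (simp only: of_nat_le_iff)
  then have dl: "real d \<le> l"
    using t q1 by (simp add: l_def le_log_iff powr_realpow)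
  have "d \<le> q ^ d" using power_gt_expt[of q d] q1 by simp
  then have dt: "d \<le> t" using d by simp
  have least: "(LEAST p. prime p \<and> p dvd t\<^sup>2) = q"
    unfolding q by (rule arg_cong[where f=Least]) (auto simp: prime_dvd_power_iff)
  have om: "omega (t\<^sup>2) = real t powr (2 * l - 1)"
  proof -
    have "t\<^sup>2 > 1" using t by (rule one_less_power) simp
    then have "omega (t\<^sup>2) = real (t\<^sup>2) powr ((log q (real (t\<^sup>2)) - 1) / 2)"
      unfolding omega_def least by simp
    also have "log q (real (t\<^sup>2)) = 2 * l"
      using t q1 by (simp add: l_def log_nat_power)
    also have "real (t\<^sup>2) = real t powr 2" using t by (simp add: powr_realpow)
    also have "(real t powr 2) powr ((2 * l - 1) / 2) = real t powr (2 * l - 1)"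
      unfolding powr_powr by (rule arg_cong[of _ _ "\<lambda>x. real t powr x"]) simp
    finally show ?thesis .
  qed
  have "real (d ^ n) = real d * real d ^ (n - 1)"
    using n by (cases n) auto
  also have "\<dots> \<le> l * real t ^ (n - 1)"
    using dl dt l1 by (intro mult_mono power_mono) auto
  also have "\<dots> \<le> (2 * l - 1) * real t ^ (n - 1)"
    using l1 by (intro mult_right_mono) auto
  finally have e: "real (d ^ n) \<le> (2 * l - 1) * real (t ^ (n - 1))" by simp
  have "real (t ^ (d ^ n)) = real t powr real (d ^ n)"
    using t by (simp add: powr_realpow[symmetric])
  also have "\<dots> \<le> real t powr ((2 * l - 1) * real (t ^ (n - 1)))"
    using t e by (intro powr_mono) auto
  also have "\<dots> = omega (t\<^sup>2) ^ (t ^ (n - 1))"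
    unfolding om powr_powr[symmetric] using t by (subst powr_realpow) auto
  finally show ?thesis .
qed

section \<open>The star operation of a skew brace of abelian type\<close>

sublocale skew_brace \<subseteq> group B
  by (rule mult_group)

sublocale skew_brace_abelian_type \<subseteq> abelian_group B
  using add_comm_group
  by (simp add: abelian_group_def abelian_group_axioms_def abelian_monoid_def comm_group_def)

context skew_brace_abelian_type
begin

lemma minus_zero [simp]: "\<ominus> \<zero> = \<zero>"
  by (rule minus_equality) simp_all

text \<open>
  These rules make the method for identities in rings available for identities that involve only the
  additive group; products and stars are then treated as atoms.
\<close>

lemmas additive_simprules
  [algebra ring "zero B" "add B" "a_inv B" "a_minus B" "one B" "mult B"] =
  a_closed zero_closed a_inv_closed minus_closed a_assoc l_zero l_neg a_comm minus_eq
  r_zero r_neg a_lcomm r_neg1 r_neg2 minus_add minus_minus minus_zero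

abbreviation star :: "'a \<Rightarrow> 'a \<Rightarrow> 'a" (infixl "\<star>" 70)
  where "a \<star> b \<equiv> brace_star B a b"

lemma star_closed [simp, intro]:
  "a \<in> carrier B \<Longrightarrow> b \<in> carrier B \<Longrightarrow> a \<star> b \<in> carrier B"
  by (simp add: brace_star_def)

lemma one_eq_zero: "\<one> = \<zero>"
proof -
  have "\<one> \<otimes> (\<zero> \<oplus> \<zero>) = \<one> \<otimes> \<zero> \<oplus> (\<ominus> \<one>) \<oplus> \<one> \<otimes> \<zero>"
    by (rule skew_distrib) simp_all
  then have "\<ominus> \<one> = \<zero>" by simp
  then have "\<ominus> (\<ominus> \<one>) = \<ominus> \<zero>" by (rule arg_cong)
  then show ?thesis by simp
qed

lemma mult_eq_add_star:
  assumes "a \<in> carrier B" "b \<in> carrier B"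
  shows "a \<otimes> b = a \<oplus> b \<oplus> a \<star> b"
proof -
  have "a \<otimes> b \<in> carrier B" using assms by simp
  with assms show ?thesis unfolding brace_star_def by algebra
qed

lemma star_add:
  assumes "a \<in> carrier B" "b \<in> carrier B" "c \<in> carrier B"
  shows "a \<star> (b \<oplus> c) = a \<star> b \<oplus> a \<star> c"
proof -
  have "a \<otimes> b \<in> carrier B" "a \<otimes> c \<in> carrier B" using assms by simp_all
  with assms show ?thesis unfolding brace_star_def skew_distrib[OF assms] by algebra
qed

lemma star_zero [simp]:
  assumes "a \<in> carrier B" shows "a \<star> \<zero> = \<zero>"
proof -
  have "a \<star> (\<zero> \<oplus> \<zero>) = a \<star> \<zero> \<oplus> a \<star> \<zero>" using assms by (intro star_add) auto
  then show ?thesis using assms by simp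
qed

lemma zero_star [simp]:
  assumes "a \<in> carrier B" shows "\<zero> \<star> a = \<zero>"
proof -
  have "\<zero> \<otimes> a = a" using l_one[OF assms] unfolding one_eq_zero .
  then show ?thesis
    using assms by (simp only: brace_star_def minus_zero l_zero r_neg)
qed

lemma star_minus:
  assumes "a \<in> carrier B" "b \<in> carrier B" shows "a \<star> (\<ominus> b) = \<ominus> (a \<star> b)"
proof -
  have "a \<star> (\<ominus> b) \<oplus> a \<star> b = \<zero>"
    using assms star_add[of a "\<ominus> b" b] by (simp add: l_neg)
  then show ?thesis using assms by (simp add: minus_equality)
qed

text \<open>
  This is \<open>\<lambda>\<^sub>a\<^sub>b = \<lambda>\<^sub>a \<lambda>\<^sub>b\<close> with each \<open>\<lambda>\<close> written as \<open>1 + \<star>\<close>; it is associativity of the product.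
\<close>

lemma mult_star:
  assumes "a \<in> carrier B" "b \<in> carrier B" "c \<in> carrier B"
  shows "(a \<otimes> b) \<star> c = a \<star> (b \<star> c) \<oplus> a \<star> c \<oplus> b \<star> c"
proof -
  have "(a \<otimes> b) \<otimes> c = a \<otimes> (b \<otimes> c)" using assms by (rule m_assoc)
  moreover have "(a \<otimes> b) \<otimes> c = (a \<oplus> b \<oplus> a \<star> b) \<oplus> c \<oplus> (a \<otimes> b) \<star> c"
    using assms mult_eq_add_star[of "a \<otimes> b" c] mult_eq_add_star[of a b] by simp
  moreover have "a \<otimes> (b \<otimes> c) =
      a \<oplus> (b \<oplus> c \<oplus> b \<star> c) \<oplus> (a \<star> b \<oplus> a \<star> c \<oplus> a \<star> (b \<star> c))"
    using assms mult_eq_add_star[of a "b \<otimes> c"] mult_eq_add_star[of b c] by (simp add: star_add)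
  ultimately have "(a \<oplus> b \<oplus> a \<star> b) \<oplus> c \<oplus> (a \<otimes> b) \<star> c =
      (a \<oplus> b \<oplus> a \<star> b) \<oplus> c \<oplus> (a \<star> (b \<star> c) \<oplus> a \<star> c \<oplus> b \<star> c)"
    using assms by (simp add: a_ac)
  then show ?thesis using assms by simp
qed

lemma inv_star_cancel:
  assumes "a \<in> carrier B" "b \<in> carrier B"
  shows "a \<star> (inv a \<star> b) \<oplus> a \<star> b \<oplus> inv a \<star> b = \<zero>"
  using mult_star[of a "inv a" b, symmetric] assms by (simp add: one_eq_zero)

lemma additive_subgroupI:
  assumes "H \<subseteq> carrier B" "\<zero> \<in> H" "\<And>x y. x \<in> H \<Longrightarrow> y \<in> H \<Longrightarrow> x \<oplus> y \<in> H"
    "\<And>x. x \<in> H \<Longrightarrow> \<ominus> x \<in> H"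
  shows "additive_subgroup H B"
  unfolding additive_subgroup_def
  by (rule add.subgroupI) (use assms in auto)

lemma additive_subgroupD:
  assumes "additive_subgroup H B"
  shows "H \<subseteq> carrier B" "\<zero> \<in> H" "\<And>x y. x \<in> H \<Longrightarrow> y \<in> H \<Longrightarrow> x \<oplus> y \<in> H"
    "\<And>x. x \<in> H \<Longrightarrow> \<ominus> x \<in> H"
  using assms additive_subgroup.a_inv_closed[OF assms]
  by (auto intro: additive_subgroup.a_subset[THEN subsetD] additive_subgroup.zero_closed additive_subgroup.a_closed)

section \<open>Ideals in terms of the star operation\<close>

text \<open>
  In a skew brace of abelian type these are exactly the ideals; closure under products and inverses
  is a consequence, so that only the additive structure has to be checked.
\<close>

definition star_ideal :: "'a set \<Rightarrow> bool"
  where "star_ideal I \<longleftrightarrow> additive_subgroup I B \<and>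
    (\<forall>b\<in>carrier B. \<forall>i\<in>I. b \<star> i \<in> I \<and> i \<star> b \<in> I)"

lemma star_idealD:
  assumes "star_ideal I"
  shows "additive_subgroup I B" "I \<subseteq> carrier B"
    "\<And>x y. x \<in> I \<Longrightarrow> y \<in> I \<Longrightarrow> x \<oplus> y \<in> I" "\<zero> \<in> I" "\<And>x. x \<in> I \<Longrightarrow> \<ominus> x \<in> I"
    "\<And>x y. x \<in> I \<Longrightarrow> y \<in> I \<Longrightarrow> x \<ominus> y \<in> I"
    "\<And>b i. b \<in> carrier B \<Longrightarrow> i \<in> I \<Longrightarrow> b \<star> i \<in> I"
    "\<And>b i. b \<in> carrier B \<Longrightarrow> i \<in> I \<Longrightarrow> i \<star> b \<in> I"
proof -
  show I: "additive_subgroup I B" using assms by (simp add: star_ideal_def)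
  note D = additive_subgroupD[OF I]
  show "I \<subseteq> carrier B" "\<zero> \<in> I" by (rule D)+
  show "x \<oplus> y \<in> I" if "x \<in> I" "y \<in> I" for x y using that by (rule D)
  show "\<ominus> x \<in> I" if "x \<in> I" for x using that by (rule D)
  show "x \<ominus> y \<in> I" if "x \<in> I" "y \<in> I" for x y unfolding a_minus_def
    using that by (intro D)
qed (use assms in \<open>auto simp: star_ideal_def\<close>)

text \<open>
  The star operation is additive on the right only. In its left argument it still respects congruence
  modulo an ideal: \<open>a + i\<close> equals \<open>a \<cdot> j\<close> for \<open>j = \<lambda>\<^sub>a\<^sup>-\<^sup>1(i) \<in> N\<close>, and left products are under control.
\<close>

lemma star_ideal_left_congruence:
  assumes N: "star_ideal N" and "a \<in> carrier B" "i \<in> N" "c \<in> carrier B"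
  shows "(a \<oplus> i) \<star> c \<ominus> a \<star> c \<in> N"
proof -
  \<comment> \<open>This is \<open>\<lambda>\<close> of the inverse of \<open>a\<close>, applied to \<open>i\<close>.\<close>
  define j where "j = i \<oplus> inv a \<star> i"
  have i: "i \<in> carrier B" using star_idealD(2)[OF N] assms by auto
  have jN: "j \<in> N" unfolding j_def using N assms by (intro star_idealD) auto
  have j: "j \<in> carrier B" using star_idealD(2)[OF N] jN by auto
  have "a \<otimes> j = (a \<oplus> i) \<oplus> (a \<star> (inv a \<star> i) \<oplus> a \<star> i \<oplus> inv a \<star> i)"
    using assms i by (simp add: mult_eq_add_star j_def star_add a_ac)
  also have "\<dots> = a \<oplus> i"
    using assms i by (simp add: inv_star_cancel)
  finally have "(a \<oplus> i) \<star> c = a \<star> (j \<star> c) \<oplus> a \<star> c \<oplus> j \<star> c"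
    using assms j mult_star[of a j c] by simp
  moreover have "a \<star> (j \<star> c) \<in> carrier B" "a \<star> c \<in> carrier B" "j \<star> c \<in> carrier B"
    using assms j by auto
  ultimately have "(a \<oplus> i) \<star> c \<ominus> a \<star> c = a \<star> (j \<star> c) \<oplus> j \<star> c"
    by algebra
  also have "\<dots> \<in> N" using N jN assms by (intro star_idealD) auto
  finally show ?thesis .
qed

text \<open>
  Additive congruence implies multiplicative congruence. Closure of ideals under products, their
  normality in \<open>(B,\<cdot>)\<close>, the agreement of the two kinds of cosets and the position of multiplicative
  commutators all follow from this.
\<close>

lemma mult_inv_in_star_ideal:
  assumes N: "star_ideal N" and "u \<in> carrier B" "v \<in> carrier B" "v \<ominus> u \<in> N"
  shows "v \<otimes> inv u \<in> N"
proof -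
  let ?i = "v \<ominus> u" and ?c = "inv u"
  have c: "?c \<in> carrier B" "?i \<in> carrier B" using assms by auto
  have v: "v = u \<oplus> ?i" using assms by algebra
  have mem: "(u \<oplus> ?i) \<star> ?c \<ominus> u \<star> ?c \<in> N"
    using star_ideal_left_congruence[OF N] assms c by blast
  have uc: "u \<oplus> ?c \<oplus> u \<star> ?c = \<zero>"
    using assms mult_eq_add_star[of u ?c] by (simp add: one_eq_zero)
  have "v \<otimes> ?c = v \<oplus> ?c \<oplus> v \<star> ?c"
    using assms by (simp add: mult_eq_add_star)
  also have "\<dots> = (u \<oplus> ?c \<oplus> u \<star> ?c) \<oplus> (?i \<oplus> (v \<star> ?c \<ominus> u \<star> ?c))"
  proof -
    have "v \<star> ?c \<in> carrier B" "u \<star> ?c \<in> carrier B" using assms c by auto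
    then show ?thesis using assms c by algebra
  qed
  also have "\<dots> = ?i \<oplus> (v \<star> ?c \<ominus> u \<star> ?c)"
    using uc assms c by simp
  also have "\<dots> \<in> N" using mem v assms by (intro star_idealD(3)[OF N]) auto
  finally show ?thesis .
qed

lemma star_ideal_subgroup:
  assumes N: "star_ideal N" shows "subgroup N B"
proof (rule subgroupI)
  show "N \<subseteq> carrier B" by (rule star_idealD(2)[OF N])
  show "N \<noteq> {}" using star_idealD(4)[OF N] by auto
  fix a assume a: "a \<in> N"
  then have ac: "a \<in> carrier B" using star_idealD(2)[OF N] by auto
  have "\<zero> \<ominus> a \<in> N" by (rule star_idealD(6)[OF N star_idealD(4)[OF N] a])
  then have "\<zero> \<otimes> inv a \<in> N" by (intro mult_inv_in_star_ideal[OF N]) (use ac in auto)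
  then have "\<one> \<otimes> inv a \<in> N" unfolding one_eq_zero .
  then show "inv a \<in> N" using ac by simp
  fix b assume b: "b \<in> N"
  then have bc: "b \<in> carrier B" using star_idealD(2)[OF N] by auto
  show "a \<otimes> b \<in> N" unfolding mult_eq_add_star[OF ac bc]
    using a b ac by (intro star_idealD[OF N])
qed

lemma star_ideal_normal:
  assumes N: "star_ideal N" shows "N \<lhd> B"
  unfolding normal_inv_iff
proof (intro conjI ballI)
  show "subgroup N B" using N by (rule star_ideal_subgroup)
  fix x h assume x: "x \<in> carrier B" and h: "h \<in> N"
  then have hc: "h \<in> carrier B" using star_idealD(2)[OF N] by auto
  have "x \<otimes> h \<ominus> x = h \<oplus> x \<star> h"
  proof -
    have "x \<star> h \<in> carrier B" using x hc by auto
    then show ?thesis unfolding mult_eq_add_star[OF x hc] using x hc by algebra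
  qed
  also have "\<dots> \<in> N" using N x h by (intro star_idealD) auto
  finally show "x \<otimes> h \<otimes> inv x \<in> N"
    by (intro mult_inv_in_star_ideal[OF N]) (use x hc in auto)
qed

lemma star_ideal_cosets_eq:
  assumes N: "star_ideal N" and b: "b \<in> carrier B"
  shows "N #> b = N +> b"
proof (intro equalityI subsetI)
  fix x assume "x \<in> N #> b"
  then obtain z where z: "z \<in> N" "x = z \<otimes> b" by (auto simp: r_coset_def)
  then have zc: "z \<in> carrier B" using star_idealD(2)[OF N] by auto
  have "x = (z \<oplus> z \<star> b) \<oplus> b" using z zc b by (simp add: mult_eq_add_star a_ac)
  moreover have "z \<oplus> z \<star> b \<in> N" using z b by (intro star_idealD[OF N]) auto
  ultimately show "x \<in> N +> b" by (auto simp: a_r_coset_def r_coset_def)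
next
  fix x assume "x \<in> N +> b"
  then obtain z where z: "z \<in> N" "x = z \<oplus> b" by (auto simp: a_r_coset_def r_coset_def)
  then have zc: "z \<in> carrier B" using star_idealD(2)[OF N] by auto
  have xc: "x \<in> carrier B" using z zc b by auto
  have "x \<ominus> b = z" using z(2) zc b by algebra
  then have "x \<otimes> inv b \<in> N" using mult_inv_in_star_ideal[OF N b xc] z by simp
  moreover have "x = (x \<otimes> inv b) \<otimes> b" using xc b by (simp add: m_assoc)
  ultimately show "x \<in> N #> b" unfolding r_coset_def by blast
qed

lemma star_ideal_brace_ideal:
  assumes N: "star_ideal N" shows "brace_ideal N B"
proof -
  have sub: "subgroup N (add_monoid B)"
    using star_idealD(1)[OF N] by (simp add: additive_subgroup_def)
  have "normal N (add_monoid B)"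
    using sub by (rule add.subgroup_imp_normal)
  moreover have "brace_star_set B (carrier B) N \<subseteq> N" "brace_star_set B N (carrier B) \<subseteq> N"
    unfolding brace_star_set_def
    by (rule add.generate_subgroup_incl[OF _ sub]; use star_idealD(7,8)[OF N] in auto)+
  ultimately show ?thesis
    unfolding brace_ideal_def subbrace_def using sub star_ideal_subgroup[OF N] by blast
qed

text \<open>
  Modulo an ideal that contains \<open>x \<star> b\<close> and \<open>b \<star> x\<close>, both \<open>x \<cdot> b\<close> and \<open>b \<cdot> x\<close> equal \<open>x + b\<close>.
\<close>

lemma brace_commutator_subset:
  assumes N: "star_ideal N" and X: "X \<subseteq> carrier B"
    and XN: "\<And>x b. x \<in> X \<Longrightarrow> b \<in> carrier B \<Longrightarrow> x \<star> b \<in> N \<and> b \<star> x \<in> N"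
  shows "brace_commutator B X (carrier B) \<subseteq> N"
proof -
  have sub: "subgroup N (add_monoid B)"
    using star_idealD(1)[OF N] by (simp add: additive_subgroup_def)
  have "commutator_subgroup (add_monoid B) X (carrier B) \<subseteq> N"
    unfolding commutator_subgroup_def
  proof (rule add.generate_subgroup_incl[OF _ sub], clarify)
    fix x b assume "x \<in> X" "b \<in> carrier B"
    then have xb: "x \<in> carrier B" "b \<in> carrier B" using X by auto
    have "x \<oplus> b \<oplus> \<ominus> x \<oplus> \<ominus> b = \<zero>" using xb by algebra
    then show "x \<otimes>\<^bsub>add_monoid B\<^esub> b \<otimes>\<^bsub>add_monoid B\<^esub> inv\<^bsub>add_monoid B\<^esub> x
        \<otimes>\<^bsub>add_monoid B\<^esub> inv\<^bsub>add_monoid B\<^esub> b \<in> N"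
      using star_idealD(4)[OF N] by (simp add: a_inv_def)
  qed
  moreover have "commutator_subgroup B X (carrier B) \<subseteq> N"
    unfolding commutator_subgroup_def
  proof (rule generate_subgroup_incl[OF _ star_ideal_subgroup[OF N]], clarify)
    fix x b assume x: "x \<in> X" and b: "b \<in> carrier B"
    then have xb: "x \<in> carrier B" using X by auto
    have "x \<otimes> b \<ominus> b \<otimes> x = x \<star> b \<ominus> b \<star> x"
    proof -
      have "x \<star> b \<in> carrier B" "b \<star> x \<in> carrier B" using xb b by auto
      then show ?thesis using xb b unfolding mult_eq_add_star[OF xb b] mult_eq_add_star[OF b xb]
        by algebra
    qed
    also have "\<dots> \<in> N" using XN x b by (intro star_idealD(6)[OF N]) auto
    finally have "(x \<otimes> b) \<otimes> inv (b \<otimes> x) \<in> N"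
      using xb b by (intro mult_inv_in_star_ideal[OF N]) auto
    then show "x \<otimes> b \<otimes> inv x \<otimes> inv b \<in> N"
      using xb b by (simp add: inv_mult_group m_assoc)
  qed
  moreover have "{(i \<otimes> j) \<ominus> (i \<oplus> j) | i j. i \<in> X \<and> j \<in> carrier B} \<subseteq> N"
  proof clarify
    fix i j assume i: "i \<in> X" and j: "j \<in> carrier B"
    then have ic: "i \<in> carrier B" using X by auto
    then have "i \<star> j \<in> carrier B" using j by auto
    then have "i \<otimes> j \<ominus> (i \<oplus> j) = i \<star> j"
      unfolding mult_eq_add_star[OF ic j] using ic j by algebra
    then show "i \<otimes> j \<ominus> (i \<oplus> j) \<in> N" using XN[OF i j] by simp
  qed
  ultimately show ?thesis
    unfolding brace_commutator_def brace_ideal_gen_def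
    by (intro Inter_lower CollectI conjI star_ideal_brace_ideal[OF N] Un_least)
qed

lemma star_in_derived_ideal:
  assumes a: "a \<in> carrier B" and b: "b \<in> carrier B"
  shows "a \<star> b \<in> derived_ideal B"
proof -
  have gen: "X \<union> Y \<union> Z \<subseteq> brace_ideal_gen B (X \<union> Y \<union> Z)" for X Y Z
    unfolding brace_ideal_gen_def by (rule Inter_greatest) simp
  have ab: "a \<star> b \<in> carrier B" using a b by (rule star_closed)
  have eq: "a \<star> b = a \<otimes> b \<ominus> (a \<oplus> b)"
    unfolding mult_eq_add_star[OF a b] using a b ab by algebra
  have "a \<star> b \<in> {i \<otimes> j \<ominus> (i \<oplus> j) | i j. i \<in> carrier B \<and> j \<in> carrier B}"
    by (rule CollectI, rule exI[of _ a], rule exI[of _ b]) (intro conjI eq a b)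
  then show ?thesis
    unfolding brace_commutator_def by (intro subsetD[OF gen] UnI2)
qed

section \<open>The kernel of \<open>\<lambda>\<close>\<close>

lemma lambda_ker_iff:
  "a \<in> brace_lambda_ker B \<longleftrightarrow> a \<in> carrier B \<and> (\<forall>b\<in>carrier B. a \<star> b = \<zero>)"
proof -
  have "brace_lambda B a b = b \<longleftrightarrow> a \<star> b = \<zero>" if "a \<in> carrier B" "b \<in> carrier B" for b
  proof -
    have ab: "a \<star> b \<in> carrier B" using that by auto
    have "brace_lambda B a b = b \<oplus> a \<star> b"
      unfolding brace_lambda_def mult_eq_add_star[OF that] using that ab by algebra
    then show ?thesis using that ab by simp
  qed
  then show ?thesis by (auto simp: brace_lambda_ker_def)
qed

text \<open>
  On \<open>ker \<lambda>\<close> the two operations agree, so it is an additive subgroup as well.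
\<close>

lemma lambda_ker_subgroup: "additive_subgroup (brace_lambda_ker B) B"
proof (rule additive_subgroupI)
  let ?K = "brace_lambda_ker B"
  have K: "a \<in> carrier B" "\<And>b. b \<in> carrier B \<Longrightarrow> a \<star> b = \<zero>" if "a \<in> ?K" for a
    using that by (auto simp: lambda_ker_iff)
  show "?K \<subseteq> carrier B" using K by auto
  show "\<zero> \<in> ?K" by (simp add: lambda_ker_iff)
  fix a assume a: "a \<in> ?K"
  note ac = K(1)[OF a]
  show "a \<oplus> b \<in> ?K" if b: "b \<in> ?K" for b
  proof -
    note bc = K(1)[OF b]
    have "a \<otimes> b = a \<oplus> b" using K(2)[OF a bc] ac bc by (simp add: mult_eq_add_star)
    then show ?thesis
      using mult_star[OF ac bc] K(2)[OF a] K(2)[OF b] ac bc by (simp add: lambda_ker_iff)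
  qed
  have "a \<otimes> (\<ominus> a) = \<zero>" using K(2)[OF a] ac by (simp add: mult_eq_add_star r_neg)
  then have "(\<ominus> a) \<star> c = \<zero>" if c: "c \<in> carrier B" for c
    using mult_star[of a "\<ominus> a" c] K(2)[OF a] ac c by simp
  then show "\<ominus> a \<in> ?K" using ac by (simp add: lambda_ker_iff)
qed

text \<open>
  If \<open>ker \<lambda>\<close> contains the derived ideal, then \<open>a \<cdot> b\<close> and \<open>b \<cdot> a\<close> differ by a factor in \<open>ker \<lambda>\<close>. Hence
  \<open>\<lambda>\<^sub>a\<close> and \<open>\<lambda>\<^sub>b\<close> commute, and so do \<open>\<lambda>\<^sub>a - 1\<close> and \<open>\<lambda>\<^sub>b - 1\<close>.
\<close>

lemma star_left_commute:
  assumes D: "derived_ideal B \<subseteq> brace_lambda_ker B"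
    and a: "a \<in> carrier B" and b: "b \<in> carrier B" and c: "c \<in> carrier B"
  shows "a \<star> (b \<star> c) = b \<star> (a \<star> c)"
proof -
  have ker: "x \<star> y \<in> brace_lambda_ker B" if "x \<in> carrier B" "y \<in> carrier B" for x y
    using D star_in_derived_ideal[OF that] by auto
  define n where "n = a \<star> b \<oplus> \<ominus> (b \<star> a)"
  have n: "n \<in> brace_lambda_ker B"
    unfolding n_def using ker a b by (intro additive_subgroupD[OF lambda_ker_subgroup])
  then have nc: "n \<in> carrier B" and n0: "\<And>x. x \<in> carrier B \<Longrightarrow> n \<star> x = \<zero>"
    by (auto simp: lambda_ker_iff)
  have cs: "a \<star> b \<in> carrier B" "b \<star> a \<in> carrier B" "a \<star> c \<in> carrier B" "b \<star> c \<in> carrier B"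
    "a \<star> (b \<star> c) \<in> carrier B" "b \<star> (a \<star> c) \<in> carrier B" "b \<otimes> a \<in> carrier B"
    using a b c by auto
  have "a \<otimes> b = n \<oplus> (b \<otimes> a)"
    unfolding n_def mult_eq_add_star[OF a b] mult_eq_add_star[OF b a] using a b cs by algebra
  also have "\<dots> = n \<otimes> (b \<otimes> a)"
    using nc cs n0 by (simp add: mult_eq_add_star[of n])
  finally have "(a \<otimes> b) \<star> c = (b \<otimes> a) \<star> c"
    using mult_star[OF nc cs(7) c] n0 c cs by simp
  then have "a \<star> (b \<star> c) \<oplus> (a \<star> c \<oplus> b \<star> c) = b \<star> (a \<star> c) \<oplus> (a \<star> c \<oplus> b \<star> c)"
    unfolding mult_star[OF a b c] mult_star[OF b a c] using cs by (simp add: a_ac)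
  then show ?thesis using cs by simp
qed

section \<open>The upper central series\<close>

text \<open>
  The preimage of the centre of the quotient by \<open>I\<close>: centrality modulo \<open>I\<close> means that both stars vanish
  modulo \<open>I\<close>.
\<close>

definition centre_mod :: "'a set \<Rightarrow> 'a set"
  where "centre_mod I = {z \<in> carrier B. \<forall>b\<in>carrier B. z \<star> b \<in> I \<and> b \<star> z \<in> I}"

lemma centre_mod_add_ideal:
  assumes I: "star_ideal I" and z: "z \<in> centre_mod I" and i: "i \<in> I"
  shows "z \<oplus> i \<in> centre_mod I"
proof -
  have zc: "z \<in> carrier B" and ic: "i \<in> carrier B"
    using z i star_idealD(2)[OF I] by (auto simp: centre_mod_def)
  have "(z \<oplus> i) \<star> b \<in> I \<and> b \<star> (z \<oplus> i) \<in> I" if b: "b \<in> carrier B" for b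
  proof
    have zb: "z \<star> b \<in> I" "b \<star> z \<in> I" using z b by (auto simp: centre_mod_def)
    have "((z \<oplus> i) \<star> b \<ominus> z \<star> b) \<oplus> z \<star> b \<in> I"
      using star_ideal_left_congruence[OF I zc i b] zb by (intro star_idealD(3)[OF I])
    moreover have "((z \<oplus> i) \<star> b \<ominus> z \<star> b) \<oplus> z \<star> b = (z \<oplus> i) \<star> b"
    proof -
      have "(z \<oplus> i) \<star> b \<in> carrier B" "z \<star> b \<in> carrier B" using zc ic b by auto
      then show ?thesis by algebra
    qed
    ultimately show "(z \<oplus> i) \<star> b \<in> I" by simp
    show "b \<star> (z \<oplus> i) \<in> I"
      unfolding star_add[OF b zc ic]
      by (rule star_idealD(3)[OF I zb(2) star_idealD(7)[OF I b i]])
  qed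
  then show ?thesis using zc ic by (simp add: centre_mod_def)
qed

text \<open>
  For sums and negatives one goes through products and inverses, for which the star operation is
  computable, and corrects by an element of \<open>I\<close>.
\<close>

lemma star_ideal_centre_mod:
  assumes I: "star_ideal I" shows "star_ideal (centre_mod I)"
proof -
  let ?C = "centre_mod I"
  have IC: "I \<subseteq> ?C" using star_idealD(2,7,8)[OF I] by (auto simp: centre_mod_def)
  have Cc: "z \<in> carrier B" if "z \<in> ?C" for z using that by (simp add: centre_mod_def)
  have CI: "z \<star> b \<in> I" "b \<star> z \<in> I" if "z \<in> ?C" "b \<in> carrier B" for z b
    using that by (auto simp: centre_mod_def)
  have "additive_subgroup ?C B"
  proof (rule additive_subgroupI)
    show "?C \<subseteq> carrier B" using Cc by auto
    show "\<zero> \<in> ?C" using IC star_idealD(4)[OF I] by auto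
    fix z assume z: "z \<in> ?C"
    have zc: "z \<in> carrier B" using z by (rule Cc)
    show "z \<oplus> w \<in> ?C" if w: "w \<in> ?C" for w
    proof -
      have wc: "w \<in> carrier B" using w by (rule Cc)
      have zw: "z \<star> w \<in> carrier B" "z \<star> w \<in> I" using z zc wc CI by auto
      have "(z \<otimes> w) \<star> c \<in> I \<and> c \<star> (z \<otimes> w) \<in> I" if c: "c \<in> carrier B" for c
      proof
        show "(z \<otimes> w) \<star> c \<in> I"
          unfolding mult_star[OF zc wc c] 
          using CI[OF z] CI[OF w] c wc by (intro star_idealD(3)[OF I]) auto
        show "c \<star> (z \<otimes> w) \<in> I"
          unfolding mult_eq_add_star[OF zc wc]
          using CI[OF z c] CI[OF w c] c wc zc zw star_idealD(3,7)[OF I]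
          by (simp add: star_add)
      qed
      then have "z \<otimes> w \<in> ?C" using zc wc by (simp add: centre_mod_def)
      then have "z \<otimes> w \<oplus> \<ominus> (z \<star> w) \<in> ?C"
        using zw star_idealD(5)[OF I] by (intro centre_mod_add_ideal[OF I]) auto
      also have "z \<otimes> w \<oplus> \<ominus> (z \<star> w) = z \<oplus> w"
        unfolding mult_eq_add_star[OF zc wc] using zc wc zw by algebra
      finally show ?thesis .
    qed
    show "\<ominus> z \<in> ?C"
    proof -
      let ?y = "inv z"
      have yc: "?y \<in> carrier B" using zc by simp
      have zy: "z \<star> ?y \<in> I" "z \<star> ?y \<in> carrier B" using CI[OF z yc] zc yc by auto
      have sum: "z \<oplus> ?y \<oplus> z \<star> ?y = \<zero>"
        using mult_eq_add_star[OF zc yc] zc by (simp add: one_eq_zero)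
      have y: "?y = \<ominus> z \<oplus> \<ominus> (z \<star> ?y)"
      proof -
        have "?y = (z \<oplus> ?y \<oplus> z \<star> ?y) \<oplus> (\<ominus> z \<oplus> \<ominus> (z \<star> ?y))"
          using zc yc zy by algebra
        then show ?thesis unfolding sum using zc zy by simp
      qed
      have "?y \<star> c \<in> I \<and> c \<star> ?y \<in> I" if c: "c \<in> carrier B" for c
      proof
        have "z \<star> (?y \<star> c) \<in> carrier B" "z \<star> c \<in> carrier B" "?y \<star> c \<in> carrier B"
          using zc yc c by auto
        then have "?y \<star> c = (z \<star> (?y \<star> c) \<oplus> z \<star> c \<oplus> ?y \<star> c) \<oplus> \<ominus> (z \<star> (?y \<star> c) \<oplus> z \<star> c)"
          by algebra
        also have "\<dots> = \<ominus> (z \<star> (?y \<star> c) \<oplus> z \<star> c)"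
          unfolding inv_star_cancel[OF zc c] using zc yc c by simp
        also have "\<dots> \<in> I"
          using CI[OF z] zc yc c by (intro star_idealD(3,5)[OF I]) auto
        finally show "?y \<star> c \<in> I" .
        have "c \<star> ?y = c \<star> (\<ominus> z \<oplus> \<ominus> (z \<star> ?y))" by (rule arg_cong[OF y])
        also have "\<dots> = \<ominus> (c \<star> z) \<oplus> \<ominus> (c \<star> (z \<star> ?y))"
          using c zc zy by (simp add: star_add star_minus)
        also have "\<dots> \<in> I"
          
          by (intro star_idealD(3,5)[OF I] CI(2)[OF z c] star_idealD(7)[OF I c zy(1)])
        finally show "c \<star> ?y \<in> I" .
      qed
      then have "?y \<in> ?C" using yc by (simp add: centre_mod_def)
      then have "?y \<oplus> z \<star> ?y \<in> ?C" using zy(1) by (rule centre_mod_add_ideal[OF I])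
      also have "?y \<oplus> z \<star> ?y = (z \<oplus> ?y \<oplus> z \<star> ?y) \<oplus> \<ominus> z" using zc yc zy by algebra
      also have "\<dots> = \<ominus> z" unfolding sum using zc by simp
      finally show ?thesis .
    qed
  qed
  moreover have "b \<star> z \<in> ?C \<and> z \<star> b \<in> ?C" if "b \<in> carrier B" "z \<in> ?C" for b z
    using CI that IC by auto
  ultimately show ?thesis by (auto simp: star_ideal_def)
qed

lemma coset_eq_iff:
  assumes I: "additive_subgroup I B" and "a \<in> carrier B" "b \<in> carrier B"
  shows "I +> a = I +> b \<longleftrightarrow> a \<ominus> b \<in> I"
proof -
  interpret I: abelian_subgroup I B
    using I abelian_group_axioms by (rule abelian_subgroupI3)
  show ?thesis
    using assms I.a_rcos_module[of b a] a_repr_independence[of a "I" b] I.a_rcos_self[of a]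
      I.a_subgroup unfolding a_minus_def by metis
qed

text \<open>
  The union that defines the product of two cosets is a single coset, because products of congruent
  elements are congruent.
\<close>

lemma coset_mult:
  assumes I: "star_ideal I" and a: "a \<in> carrier B" and b: "b \<in> carrier B"
  shows "rcoset_mult B I (I +> a) (I +> b) = I +> (a \<otimes> b)"
proof -
  have rep: "I +> (x \<otimes> y) = I +> (a \<otimes> b)" if "x \<in> I +> a" "y \<in> I +> b" for x y
  proof -
    from that obtain i j where i: "i \<in> I" "x = i \<oplus> a" and j: "j \<in> I" "y = j \<oplus> b"
      by (auto simp: a_r_coset_def r_coset_def)
    have ij: "i \<in> carrier B" "j \<in> carrier B" using star_idealD(2)[OF I] i j by auto
    have xy: "x \<in> carrier B" "y \<in> carrier B" using i j ij a b by auto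
    have d: "(a \<oplus> i) \<star> b \<ominus> a \<star> b \<in> I"
      using star_ideal_left_congruence[OF I a i(1) b] .
    have x: "a \<oplus> i = x" using i ij a by (simp add: a_comm)
    have "x \<otimes> y = (i \<oplus> a) \<oplus> (j \<oplus> b) \<oplus> (x \<star> j \<oplus> x \<star> b)"
      using xy i j ij b by (simp add: mult_eq_add_star star_add)
    moreover have "a \<otimes> b = a \<oplus> b \<oplus> a \<star> b" using a b by (rule mult_eq_add_star)
    moreover have "x \<star> j \<in> carrier B" "x \<star> b \<in> carrier B" "a \<star> b \<in> carrier B" using xy ij a b by auto
    ultimately have "x \<otimes> y \<ominus> a \<otimes> b = i \<oplus> j \<oplus> x \<star> j \<oplus> (x \<star> b \<ominus> a \<star> b)"
      using ij a b by algebra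
    also have "\<dots> \<in> I"
      by (intro star_idealD(3)[OF I] star_idealD(7)[OF I xy(1) j(1)] d[unfolded x] i(1) j(1))
    finally show ?thesis
      using coset_eq_iff[OF star_idealD(1)[OF I], of "x \<otimes> y" "a \<otimes> b"] xy a b by simp
  qed
  have "\<zero> \<oplus> a \<in> I +> a" "\<zero> \<oplus> b \<in> I +> b"
    using star_idealD(4)[OF I] unfolding a_r_coset_def r_coset_def by auto
  then show ?thesis unfolding rcoset_mult_def using rep by blast
qed

text \<open>
  The condition on \<open>\<lambda>\<close> says that \<open>z \<star> b\<close> vanishes modulo \<open>I\<close>. Since \<open>z \<cdot> b - b \<cdot> z = z \<star> b - b \<star> z\<close>, commuting
  with \<open>b\<close> then amounts to the same for \<open>b \<star> z\<close>.
\<close>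

lemma brace_centre_quotient_iff:
  assumes I: "star_ideal I" and z: "z \<in> carrier B"
  shows "I +> z \<in> brace_centre (B Quot I) \<longleftrightarrow> z \<in> centre_mod I"
proof -
  let ?Q = "B Quot I"
  interpret I: abelian_subgroup I B
    using star_idealD(1)[OF I] abelian_group_axioms by (rule abelian_subgroupI3)
  have carr: "carrier ?Q = (\<lambda>b. I +> b) ` carrier B"
    by (auto simp: FactRing_def A_RCOSETS_def RCOSETS_def a_r_coset_def)
  have add: "(I +> a) \<oplus>\<^bsub>?Q\<^esub> (I +> b) = I +> (a \<oplus> b)" if "a \<in> carrier B" "b \<in> carrier B" for a b
    using I.a_rcos_sum that by (simp add: FactRing_def)
  have mult: "(I +> a) \<otimes>\<^bsub>?Q\<^esub> (I +> b) = I +> (a \<otimes> b)" if "a \<in> carrier B" "b \<in> carrier B" for a b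
    using coset_mult[OF I] that by (simp add: FactRing_def)
  have "add_monoid ?Q = B A_Mod I"
    by (simp add: A_FactGroup_def' FactRing_def)
  then have "comm_group (add_monoid ?Q)"
    using I.a_factorgroup_is_comm_group by simp
  then interpret Q: comm_group "add_monoid ?Q" .
  have zeroQ: "\<zero>\<^bsub>?Q\<^esub> = I +> \<zero>"
    using a_coset_join2[of \<zero> I] I.a_subgroup star_idealD(4)[OF I] by (simp add: FactRing_def)
  have neg: "\<ominus>\<^bsub>?Q\<^esub> (I +> a) = I +> (\<ominus> a)" if a: "a \<in> carrier B" for a
    unfolding a_inv_def[of ?Q]
    by (rule Q.inv_equality) (use a add[of "\<ominus> a" a] carr zeroQ in \<open>auto simp: l_neg\<close>)
  have lam: "brace_lambda ?Q (I +> z) (I +> b) = I +> b \<longleftrightarrow> z \<star> b \<in> I" if b: "b \<in> carrier B" for b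
  proof -
    have zb: "z \<star> b \<in> carrier B" using z b by auto
    have "brace_lambda ?Q (I +> z) (I +> b) = I +> (\<ominus> z \<oplus> (z \<otimes> b))"
      using z b by (simp add: brace_lambda_def mult neg add)
    moreover have "\<ominus> z \<oplus> (z \<otimes> b) \<ominus> b = z \<star> b"
      unfolding mult_eq_add_star[OF z b] using z b zb by algebra
    ultimately show ?thesis
      using coset_eq_iff[OF star_idealD(1)[OF I], of "\<ominus> z \<oplus> (z \<otimes> b)" b] z b by simp
  qed
  have comm: "(I +> z) \<otimes>\<^bsub>?Q\<^esub> (I +> b) = (I +> b) \<otimes>\<^bsub>?Q\<^esub> (I +> z) \<longleftrightarrow> z \<star> b \<ominus> b \<star> z \<in> I"
    if b: "b \<in> carrier B" for b
  proof -
    have "z \<star> b \<in> carrier B" "b \<star> z \<in> carrier B" using z b by auto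
    then have "z \<otimes> b \<ominus> b \<otimes> z = z \<star> b \<ominus> b \<star> z"
      unfolding mult_eq_add_star[OF z b] mult_eq_add_star[OF b z] using z b by algebra
    then show ?thesis
      using coset_eq_iff[OF star_idealD(1)[OF I], of "z \<otimes> b" "b \<otimes> z"] z b by (simp add: mult)
  qed
  have "I +> z \<in> brace_centre ?Q \<longleftrightarrow>
      (\<forall>b\<in>carrier B. z \<star> b \<in> I) \<and> (\<forall>b\<in>carrier B. z \<star> b \<ominus> b \<star> z \<in> I)"
  proof -
    have "I +> z \<in> carrier ?Q" using z by (simp add: carr)
    moreover have "(I +> z) \<oplus>\<^bsub>?Q\<^esub> (I +> b) = (I +> b) \<oplus>\<^bsub>?Q\<^esub> (I +> z)"
      if "b \<in> carrier B" for b
      using z that by (simp add: add a_comm)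
    ultimately show ?thesis
      unfolding brace_centre_def brace_lambda_ker_def group_centre_def
      by (simp add: carr lam comm)
  qed
  also have "\<dots> \<longleftrightarrow> z \<in> centre_mod I"
  proof -
    have "b \<star> z \<in> I \<longleftrightarrow> z \<star> b \<ominus> b \<star> z \<in> I" if b: "b \<in> carrier B" and zb: "z \<star> b \<in> I" for b
    proof
      assume d: "z \<star> b \<ominus> b \<star> z \<in> I"
      have "z \<star> b \<in> carrier B" "b \<star> z \<in> carrier B" using z b by auto
      then have "b \<star> z = z \<star> b \<ominus> (z \<star> b \<ominus> b \<star> z)" by algebra
      then show "b \<star> z \<in> I" using star_idealD(6)[OF I zb d] by simp
    qed (use zb star_idealD(6)[OF I] in auto)
    then show ?thesis using z by (auto simp: centre_mod_def)
  qed
  finally show ?thesis .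
qed

lemma star_ideal_zero: "star_ideal {\<zero>}"
proof -
  have "additive_subgroup {\<zero>} B" by (rule additive_subgroupI) auto
  then show ?thesis by (auto simp: star_ideal_def)
qed

lemma star_ideal_upper_central: "star_ideal (brace_upper_central B n)"
  and upper_central_Suc: "brace_upper_central B (Suc n) = centre_mod (brace_upper_central B n)"
proof -
  have step: "brace_upper_central B (Suc n) = centre_mod (brace_upper_central B n)"
    if "star_ideal (brace_upper_central B n)" for n
    using brace_centre_quotient_iff[OF that] by (auto simp: centre_mod_def)
  have ideal: "star_ideal (brace_upper_central B n)" for n
  proof (induction n)
    case 0
    show ?case using star_ideal_zero by simp
  next
    case (Suc n)
    then show ?case using star_ideal_centre_mod[OF Suc] step[OF Suc] by simp
  qed
  show "star_ideal (brace_upper_central B n)" by (rule ideal)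
  show "brace_upper_central B (Suc n) = centre_mod (brace_upper_central B n)"
    by (rule step[OF ideal])
qed

lemma brace_centre_eq_upper_central: "brace_centre B = brace_upper_central B 1"
proof -
  have comm: "z \<otimes> b = b \<otimes> z \<longleftrightarrow> b \<star> z = \<zero>"
    if "z \<in> carrier B" "b \<in> carrier B" "z \<star> b = \<zero>" for z b
    using that by (simp add: mult_eq_add_star a_comm[of b z])
  have "z \<in> brace_centre B \<longleftrightarrow> z \<in> centre_mod {\<zero>}" for z
  proof (cases "z \<in> carrier B")
    case True
    then have "z \<in> brace_centre B \<longleftrightarrow>
        (\<forall>b\<in>carrier B. z \<star> b = \<zero>) \<and> (\<forall>b\<in>carrier B. z \<otimes> b = b \<otimes> z)"
      unfolding brace_centre_def Int_iff lambda_ker_iff group_centre_def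
      by (simp add: a_comm[of z])
    also have "\<dots> \<longleftrightarrow> z \<in> centre_mod {\<zero>}"
      using True comm[OF True] by (auto simp: centre_mod_def)
    finally show ?thesis .
  qed (simp add: brace_centre_def brace_lambda_ker_def centre_mod_def)
  then show ?thesis using upper_central_Suc[of 0] by auto
qed

lemma star_upper_central:
  assumes "z \<in> brace_upper_central B (Suc n)" "b \<in> carrier B"
  shows "z \<star> b \<in> brace_upper_central B n" "b \<star> z \<in> brace_upper_central B n"
  using assms unfolding upper_central_Suc centre_mod_def by auto

section \<open>Iterated star products and the lower central series\<close>

lemma star_set_subgroup:
  assumes "X \<subseteq> carrier B" "Y \<subseteq> carrier B"
  shows "additive_subgroup (brace_star_set B X Y) B"
  unfolding brace_star_set_def additive_subgroup_def
  by (rule add.generate_is_subgroup) (use assms in auto)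

lemma star_in_star_set: "x \<in> X \<Longrightarrow> y \<in> Y \<Longrightarrow> x \<star> y \<in> brace_star_set B X Y"
  unfolding brace_star_set_def by (rule generate.incl) blast

lemma star_set_least:
  assumes "additive_subgroup H B" "\<And>x y. x \<in> X \<Longrightarrow> y \<in> Y \<Longrightarrow> x \<star> y \<in> H"
  shows "brace_star_set B X Y \<subseteq> H"
  unfolding brace_star_set_def
  by (rule add.generate_subgroup_incl) (use assms in \<open>auto simp: additive_subgroup_def\<close>)

text \<open>
  The group \<open>B * (B * \<dots> (B * B))\<close> with \<open>k\<close> stars; the index is one less than that of the term of the lower
  central series that it bounds.
\<close>

primrec star_power :: "nat \<Rightarrow> 'a set" where
  "star_power 0 = carrier B"
| "star_power (Suc k) = brace_star_set B (carrier B) (star_power k)"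

lemma star_power_subgroup: "additive_subgroup (star_power k) B"
proof (induction k)
  case 0
  show ?case by (rule additive_subgroupI) auto
next
  case (Suc k)
  then show ?case by (auto intro!: star_set_subgroup dest: additive_subgroupD)
qed

lemma star_power_Suc_subset: "star_power (Suc k) \<subseteq> star_power k"
proof (induction k)
  case 0
  show ?case using additive_subgroupD(1)[OF star_power_subgroup[of "Suc 0"]] by simp
next
  case (Suc k)
  show ?case
    unfolding star_power.simps(2)[of "Suc k"]
  proof (rule star_set_least[OF star_power_subgroup])
    fix b m assume b: "b \<in> carrier B" and "m \<in> star_power (Suc k)"
    then have "m \<in> star_power k" using Suc.IH by blast
    then show "b \<star> m \<in> star_power (Suc k)"
      unfolding star_power.simps using b by (intro star_in_star_set)
  qed
qed

lemma star_in_star_power: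
  assumes "b \<in> carrier B" "m \<in> star_power k" shows "b \<star> m \<in> star_power k"
proof (rule subsetD[OF star_power_Suc_subset])
  show "b \<star> m \<in> star_power (Suc k)"
    unfolding star_power.simps using assms by (rule star_in_star_set)
qed

lemma star_power_subset_lambda_ker:
  assumes "derived_ideal B \<subseteq> brace_lambda_ker B"
  shows "star_power (Suc k) \<subseteq> brace_lambda_ker B"
  unfolding star_power.simps
proof (rule star_set_least[OF lambda_ker_subgroup])
  fix x y assume "x \<in> carrier B" "y \<in> star_power k"
  then show "x \<star> y \<in> brace_lambda_ker B"
    using assms star_in_derived_ideal additive_subgroupD(1)[OF star_power_subgroup] by blast
qed

text \<open>
  For \<open>k = 0\<close> the right factor ranges over all of \<open>B\<close>, so the star on the other side is again a
  generator; for \<open>k > 0\<close> it is zero, because the left argument lies in \<open>ker \<lambda>\<close>.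
\<close>

lemma star_power_star:
  assumes "k = 0 \<or> derived_ideal B \<subseteq> brace_lambda_ker B"
    and x: "x \<in> star_power k" and b: "b \<in> carrier B"
  shows "x \<star> b \<in> star_power (Suc k)"
proof (cases k)
  case 0
  then show ?thesis using x b star_in_star_set[of x "carrier B" b "carrier B"] by simp
next
  case (Suc j)
  then have "x \<in> brace_lambda_ker B"
    using star_power_subset_lambda_ker[of j] assms(1) x by blast
  then have "x \<star> b = \<zero>" using b lambda_ker_iff by blast
  then show ?thesis using additive_subgroupD(2)[OF star_power_subgroup] by metis
qed

lemma star_ideal_star_power:
  assumes "k = 0 \<or> derived_ideal B \<subseteq> brace_lambda_ker B"
  shows "star_ideal (star_power (Suc k))"
proof -
  have "i \<star> b \<in> star_power (Suc k)" if "i \<in> star_power (Suc k)" "b \<in> carrier B" for i b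
    using assms subsetD[OF star_power_Suc_subset that(1)] that(2) by (rule star_power_star)
  then show ?thesis
    unfolding star_ideal_def using star_power_subgroup star_in_star_power by blast
qed

lemma lower_central_subset_star_power:
  assumes "k \<le> 1 \<or> derived_ideal B \<subseteq> brace_lambda_ker B"
  shows "brace_lower_central B (Suc k) \<subseteq> star_power k"
  using assms
proof (induction k)
  case 0
  show ?case by simp
next
  case (Suc k)
  have k: "k = 0 \<or> derived_ideal B \<subseteq> brace_lambda_ker B" using Suc.prems by auto
  have IH: "brace_lower_central B (Suc k) \<subseteq> star_power k" using Suc by auto
  have N: "star_ideal (star_power (Suc k))" using k by (rule star_ideal_star_power)
  have Lc: "star_power k \<subseteq> carrier B" using additive_subgroupD(1)[OF star_power_subgroup] .
  have "x \<star> b \<in> star_power (Suc k) \<and> b \<star> x \<in> star_power (Suc k)"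
    if x: "x \<in> brace_lower_central B (Suc k)" and b: "b \<in> carrier B" for x b
  proof
    have xk: "x \<in> star_power k" using x IH by auto
    show "x \<star> b \<in> star_power (Suc k)" using k xk b by (rule star_power_star)
    show "b \<star> x \<in> star_power (Suc k)" using star_in_star_set[OF b xk] by simp
  qed
  then show ?case
    using brace_commutator_subset[OF N, of "brace_lower_central B (Suc k)"] IH Lc
    unfolding brace_lower_central.simps by blast
qed

text \<open>
  Elements \<open>z\<close> of \<open>Z\<^sub>n\<close> act on \<open>L\<^sub>k\<close> trivially modulo \<open>Z\<^sub>n\<^sub>-\<^sub>k\<^sub>-\<^sub>1\<close> (the index \<open>j\<close> below): on a generator,
  \<open>z \<star> (b \<star> y) = b \<star> (z \<star> y)\<close>, and the outer star moves one step down the upper central series.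
\<close>

lemma upper_central_star_star_power:
  assumes "k = 0 \<or> derived_ideal B \<subseteq> brace_lambda_ker B"
    and z: "z \<in> brace_upper_central B (Suc (j + k))" and m: "m \<in> star_power k"
  shows "z \<star> m \<in> brace_upper_central B j"
  using assms(1) z m
proof (induction k arbitrary: j m)
  case 0
  then show ?case using star_upper_central(1) by simp
next
  case (Suc k)
  let ?Z = "brace_upper_central B j"
  note Z = star_idealD[OF star_ideal_upper_central[of j]]
  have D: "derived_ideal B \<subseteq> brace_lambda_ker B" using Suc.prems by simp
  have zc: "z \<in> carrier B"
    using Suc.prems(2) star_idealD(2)[OF star_ideal_upper_central] by blast
  have "additive_subgroup {m \<in> carrier B. z \<star> m \<in> ?Z} B"
    by (rule additive_subgroupI) (use zc Z(3-5) in \<open>auto simp: star_add star_minus\<close>)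
  moreover have "b \<star> y \<in> {m \<in> carrier B. z \<star> m \<in> ?Z}"
    if b: "b \<in> carrier B" and y: "y \<in> star_power k" for b y
  proof -
    have yc: "y \<in> carrier B" using y additive_subgroupD(1)[OF star_power_subgroup] by blast
    have "z \<star> y \<in> brace_upper_central B (Suc j)"
      using Suc.IH[of "Suc j" y] Suc.prems(2) D y by simp
    then have "b \<star> (z \<star> y) \<in> ?Z" using b by (rule star_upper_central(2))
    then show ?thesis using star_left_commute[OF D zc b yc] b yc by simp
  qed
  ultimately have "star_power (Suc k) \<subseteq> {m \<in> carrier B. z \<star> m \<in> ?Z}"
    unfolding star_power.simps by (rule star_set_least)
  then show ?case using Suc.prems(3) by auto
qed

section \<open>Covering iterated star products by cosets\<close>

text \<open>
  A coset cover \<open>M \<subseteq> R + V\<close> is used instead of the index of \<open>V\<close> in \<open>M + V\<close>, since covers pass to images and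
  sums without any quotient groups. The group \<open>K\<close> is the sum of \<open>W\<close> and the images of \<open>M\<close> under the
  additive maps \<open>m \<mapsto> x \<star> m\<close>, and each of these images needs at most \<open>card R\<close> cosets of \<open>W\<close>.
\<close>

lemma cover_finite_sum:
  assumes M: "additive_subgroup M B" and W: "additive_subgroup W B"
    and R: "finite R" "R \<subseteq> carrier B" and cover: "M \<subseteq> R <+>\<^bsub>B\<^esub> V" and V: "V \<subseteq> carrier B"
    and VW: "\<And>b v. b \<in> carrier B \<Longrightarrow> v \<in> V \<Longrightarrow> b \<star> v \<in> W"
    and X: "finite X" "X \<subseteq> carrier B"
  shows "\<exists>K R'. additive_subgroup K B \<and> W \<subseteq> K \<and> (\<forall>x\<in>X. \<forall>m\<in>M. x \<star> m \<in> K) \<and>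
    finite R' \<and> R' \<subseteq> carrier B \<and> card R' \<le> card R ^ card X \<and> K \<subseteq> R' <+>\<^bsub>B\<^esub> W"
  using X
proof (induction X rule: finite_induct)
  case empty
  have "W \<subseteq> {\<zero>} <+>\<^bsub>B\<^esub> W"
  proof
    fix w assume w: "w \<in> W"
    then have "w = \<zero> \<oplus> w" using additive_subgroupD(1)[OF W] by auto
    then show "w \<in> {\<zero>} <+>\<^bsub>B\<^esub> W" using w unfolding set_add_def' by blast
  qed
  then show ?case using W by (intro exI[of _ W] exI[of _ "{\<zero>}"]) auto
next
  case (insert x X)
  then obtain K R' where K: "additive_subgroup K B" "W \<subseteq> K"
      and XK: "\<And>y m. y \<in> X \<Longrightarrow> m \<in> M \<Longrightarrow> y \<star> m \<in> K"
      and R': "finite R'" "R' \<subseteq> carrier B" "card R' \<le> card R ^ card X" "K \<subseteq> R' <+>\<^bsub>B\<^esub> W"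
    by auto
  have x: "x \<in> carrier B" using insert.prems by auto
  note Mc = additive_subgroupD(1)[OF M, THEN subsetD] and Kc = additive_subgroupD(1)[OF K(1), THEN subsetD]
    and Wc = additive_subgroupD(1)[OF W, THEN subsetD]
  define K' where "K' = {x \<star> m \<oplus> k | m k. m \<in> M \<and> k \<in> K}"
  define S where "S = (\<lambda>(r, s). x \<star> r \<oplus> s) ` (R \<times> R')"
  have K'I: "x \<star> m \<oplus> k \<in> K'" if "m \<in> M" "k \<in> K" for m k using that by (auto simp: K'_def)
  have "additive_subgroup K' B"
  proof (rule additive_subgroupI)
    show "K' \<subseteq> carrier B" using x Mc Kc by (auto simp: K'_def)
    show "\<zero> \<in> K'" using K'I[of \<zero> \<zero>] additive_subgroupD(2)[OF M] additive_subgroupD(2)[OF K(1)] x by simp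
    fix u assume "u \<in> K'"
    then obtain m k where u: "u = x \<star> m \<oplus> k" "m \<in> M" "k \<in> K" by (auto simp: K'_def)
    have c: "m \<in> carrier B" "k \<in> carrier B" "x \<star> m \<in> carrier B" using u x Mc Kc by auto
    have "\<ominus> u = x \<star> (\<ominus> m) \<oplus> \<ominus> k"
      unfolding u(1) star_minus[OF x c(1)] using c by algebra
    then show "\<ominus> u \<in> K'"
      using K'I[of "\<ominus> m" "\<ominus> k"] u additive_subgroupD(4)[OF M] additive_subgroupD(4)[OF K(1)] by simp
    fix v assume "v \<in> K'"
    then obtain m' k' where v: "v = x \<star> m' \<oplus> k'" "m' \<in> M" "k' \<in> K" by (auto simp: K'_def)
    have c': "m' \<in> carrier B" "k' \<in> carrier B" "x \<star> m' \<in> carrier B" using v x Mc Kc by auto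
    have "u \<oplus> v = x \<star> (m \<oplus> m') \<oplus> (k \<oplus> k')"
      unfolding u(1) v(1) star_add[OF x c(1) c'(1)] using c c' by algebra
    then show "u \<oplus> v \<in> K'"
      using K'I[of "m \<oplus> m'" "k \<oplus> k'"] u v additive_subgroupD(3)[OF M] additive_subgroupD(3)[OF K(1)] by simp
  qed
  moreover have KK': "K \<subseteq> K'"
  proof
    fix k assume k: "k \<in> K"
    then show "k \<in> K'" using K'I[OF additive_subgroupD(2)[OF M] k] x Kc by simp
  qed
  moreover have "y \<star> m \<in> K'" if "y \<in> insert x X" and m: "m \<in> M" for y m
  proof (cases "y = x")
    case True
    then show ?thesis using K'I[OF m additive_subgroupD(2)[OF K(1)]] x Mc[OF m] by simp
  next
    case False
    then show ?thesis using that XK KK' by blast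
  qed
  moreover have "finite S" "S \<subseteq> carrier B"
    using R R' x by (auto simp: S_def)
  moreover have "card S \<le> card R ^ card (insert x X)"
  proof -
    have "card S \<le> card (R \<times> R')" unfolding S_def using R R' by (intro card_image_le) auto
    also have "\<dots> \<le> card R * card R ^ card X"
      using R'(3) by (simp add: card_cartesian_product)
    finally show ?thesis using insert.hyps by simp
  qed
  moreover have "K' \<subseteq> S <+>\<^bsub>B\<^esub> W"
  proof
    fix u assume "u \<in> K'"
    then obtain m k where u: "u = x \<star> m \<oplus> k" "m \<in> M" "k \<in> K" by (auto simp: K'_def)
    obtain r v where r: "r \<in> R" "v \<in> V" "m = r \<oplus> v" using u(2) cover by (auto simp: set_add_def')
    obtain s w where s: "s \<in> R'" "w \<in> W" "k = s \<oplus> w" using u(3) R'(4) by (auto simp: set_add_def')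
    have xv: "x \<star> v \<in> W" using VW x r(2) by blast
    have c: "r \<in> carrier B" "v \<in> carrier B" "s \<in> carrier B" "w \<in> carrier B"
        "x \<star> r \<in> carrier B" "x \<star> v \<in> carrier B"
      using r s R R' V Wc x by auto
    have "u = (x \<star> r \<oplus> s) \<oplus> (x \<star> v \<oplus> w)"
      unfolding u(1) r(3) s(3) star_add[OF x c(1,2)] using c by algebra
    moreover have "x \<star> r \<oplus> s \<in> S" using r s by (auto simp: S_def)
    moreover have "x \<star> v \<oplus> w \<in> W" using xv s(2) by (rule additive_subgroupD(3)[OF W])
    ultimately show "u \<in> S <+>\<^bsub>B\<^esub> W" by (auto simp: set_add_def')
  qed
  ultimately show ?case using K(2) by (intro exI[of _ K'] exI[of _ S]) auto
qed

text \<open>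
  The elements \<open>b\<close> with \<open>b \<star> M \<subseteq> K\<close> form a subgroup of \<open>(B,\<cdot>)\<close>, because \<open>M\<close> is stable under the action.
  It contains \<open>X\<close> and \<open>Z\<close>, so it is everything: this is the fact that an augmentation ideal is generated
  by the elements \<open>x - 1\<close> for \<open>x\<close> in a generating set.
\<close>

lemma cover_star_set:
  assumes M: "additive_subgroup M B" and Minv: "\<And>b m. b \<in> carrier B \<Longrightarrow> m \<in> M \<Longrightarrow> b \<star> m \<in> M"
    and W: "additive_subgroup W B"
    and R: "finite R" "R \<subseteq> carrier B" and cover: "M \<subseteq> R <+>\<^bsub>B\<^esub> V" and V: "V \<subseteq> carrier B"
    and VW: "\<And>b v. b \<in> carrier B \<Longrightarrow> v \<in> V \<Longrightarrow> b \<star> v \<in> W"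
    and X: "finite X" "X \<subseteq> carrier B"
    and gen: "\<And>H. subgroup H B \<Longrightarrow> Z \<subseteq> H \<Longrightarrow> X \<subseteq> H \<Longrightarrow> H = carrier B"
    and Z: "Z \<subseteq> carrier B" "\<And>z m. z \<in> Z \<Longrightarrow> m \<in> M \<Longrightarrow> z \<star> m \<in> W"
  shows "\<exists>R'. finite R' \<and> R' \<subseteq> carrier B \<and> card R' \<le> card R ^ card X \<and>
    brace_star_set B (carrier B) M \<subseteq> R' <+>\<^bsub>B\<^esub> W"
proof -
  obtain K R' where K: "additive_subgroup K B" "W \<subseteq> K"
      and XK: "\<And>y m. y \<in> X \<Longrightarrow> m \<in> M \<Longrightarrow> y \<star> m \<in> K"
      and R': "finite R'" "R' \<subseteq> carrier B" "card R' \<le> card R ^ card X" "K \<subseteq> R' <+>\<^bsub>B\<^esub> W"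
    using cover_finite_sum[OF M W R cover V VW X] by blast
  define H where "H = {b \<in> carrier B. \<forall>m\<in>M. b \<star> m \<in> K}"
  note Mc = additive_subgroupD(1)[OF M, THEN subsetD]
  have "subgroup H B"
  proof (rule subgroupI)
    show "H \<subseteq> carrier B" by (auto simp: H_def)
    have "\<zero> \<in> H" using Mc additive_subgroupD(2)[OF K(1)] by (auto simp: H_def)
    then show "H \<noteq> {}" by auto
    fix a assume a: "a \<in> H"
    then have ac: "a \<in> carrier B" and aK: "\<And>m. m \<in> M \<Longrightarrow> a \<star> m \<in> K" by (auto simp: H_def)
    have "inv a \<star> m \<in> K" if m: "m \<in> M" for m
    proof -
      have mc: "m \<in> carrier B" using m by (rule Mc)
      have im: "inv a \<star> m \<in> M" using Minv ac m by auto
      have c: "inv a \<star> m \<in> carrier B" "a \<star> (inv a \<star> m) \<in> carrier B" "a \<star> m \<in> carrier B"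
        using ac mc by auto
      then have "inv a \<star> m = (a \<star> (inv a \<star> m) \<oplus> a \<star> m \<oplus> inv a \<star> m) \<oplus> \<ominus> (a \<star> (inv a \<star> m) \<oplus> a \<star> m)"
        by algebra
      also have "\<dots> = \<ominus> (a \<star> (inv a \<star> m) \<oplus> a \<star> m)"
        unfolding inv_star_cancel[OF ac mc] using c by simp
      also have "\<dots> \<in> K"
        by (intro additive_subgroupD(3,4)[OF K(1)] aK im m)
      finally show ?thesis .
    qed
    then show "inv a \<in> H" using ac by (simp add: H_def)
    fix b assume b: "b \<in> H"
    then have bc: "b \<in> carrier B" and bK: "\<And>m. m \<in> M \<Longrightarrow> b \<star> m \<in> K" by (auto simp: H_def)
    have "(a \<otimes> b) \<star> m \<in> K" if m: "m \<in> M" for m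
      unfolding mult_star[OF ac bc Mc[OF m]]
      by (intro additive_subgroupD(3)[OF K(1)] aK bK m Minv bc)
    then show "a \<otimes> b \<in> H" using ac bc by (simp add: H_def)
  qed
  moreover have "Z \<subseteq> H" using Z K(2) by (auto simp: H_def)
  moreover have "X \<subseteq> H" using X XK by (auto simp: H_def)
  ultimately have "H = carrier B" by (rule gen)
  then have "brace_star_set B (carrier B) M \<subseteq> K"
    by (intro star_set_least[OF K(1)]) (auto simp: H_def)
  then show ?thesis using R' by blast
qed

lemma carrier_cover:
  assumes I: "additive_subgroup I B" and fin: "finite (carrier (B Quot I))"
  shows "\<exists>R. finite R \<and> R \<subseteq> carrier B \<and> card R \<le> card (carrier (B Quot I)) \<and> carrier B \<subseteq> R <+>\<^bsub>B\<^esub> I"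
proof -
  interpret I: abelian_subgroup I B
    using I abelian_group_axioms by (rule abelian_subgroupI3)
  have carr: "carrier (B Quot I) = (\<lambda>b. I +> b) ` carrier B"
    by (auto simp: FactRing_def A_RCOSETS_def RCOSETS_def a_r_coset_def)
  define f where "f = inv_into (carrier B) (\<lambda>b. I +> b)"
  have f: "f Y \<in> carrier B" "I +> f Y = Y" if "Y \<in> carrier (B Quot I)" for Y
    using that inv_into_into[of Y "\<lambda>b. I +> b" "carrier B"]
      f_inv_into_f[of Y "\<lambda>b. I +> b" "carrier B"] unfolding carr f_def by blast+
  have "b \<in> f ` carrier (B Quot I) <+>\<^bsub>B\<^esub> I" if b: "b \<in> carrier B" for b
  proof -
    have Y: "I +> b \<in> carrier (B Quot I)" using b carr by auto
    have "b \<in> I +> f (I +> b)" unfolding f(2)[OF Y] using b by (rule I.a_rcos_self)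
    then obtain i where i: "i \<in> I" "b = i \<oplus> f (I +> b)" by (auto simp: a_r_coset_def r_coset_def)
    then have "b = f (I +> b) \<oplus> i"
      using a_comm[of i "f (I +> b)"] f(1)[OF Y] additive_subgroupD(1)[OF I] by auto
    then show ?thesis using i(1) Y unfolding set_add_def' by blast
  qed
  then show ?thesis
    using f(1) fin by (intro exI[of _ "f ` carrier (B Quot I)"]) (auto intro: card_image_le)
qed

text \<open>
  Each step raises the number of cosets to the power \<open>card X\<close> and lowers the term of the upper central
  series by one.
\<close>

lemma star_power_cover:
  assumes "n = 1 \<or> derived_ideal B \<subseteq> brace_lambda_ker B"
    and fin: "finite (carrier (B Quot brace_upper_central B n))"
    and X: "finite X" "X \<subseteq> carrier B"
    and gen: "\<And>H. subgroup H B \<Longrightarrow> brace_upper_central B n \<subseteq> H \<Longrightarrow> X \<subseteq> H \<Longrightarrow> H = carrier B"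
    and "k \<le> n"
  shows "\<exists>R. finite R \<and> R \<subseteq> carrier B \<and>
    card R \<le> card (carrier (B Quot brace_upper_central B n)) ^ (card X ^ k) \<and>
    star_power k \<subseteq> R <+>\<^bsub>B\<^esub> brace_upper_central B (n - k)"
  using \<open>k \<le> n\<close>
proof (induction k)
  case 0
  show ?case using carrier_cover[OF star_idealD(1)[OF star_ideal_upper_central] fin] by simp
next
  case (Suc k)
  let ?t = "card (carrier (B Quot brace_upper_central B n))"
  have step: "n - k = Suc (n - Suc k)" and n_eq: "Suc (n - Suc k + k) = n" using Suc.prems by auto
  obtain R where R: "finite R" "R \<subseteq> carrier B" "card R \<le> ?t ^ (card X ^ k)"
      "star_power k \<subseteq> R <+>\<^bsub>B\<^esub> brace_upper_central B (n - k)"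
    using Suc.IH[OF Suc_leD[OF Suc.prems]] by blast
  note ideal = star_ideal_upper_central
  have k: "k = 0 \<or> derived_ideal B \<subseteq> brace_lambda_ker B" using assms(1) Suc.prems by auto
  have "\<exists>R'. finite R' \<and> R' \<subseteq> carrier B \<and> card R' \<le> card R ^ card X \<and>
    brace_star_set B (carrier B) (star_power k) \<subseteq> R' <+>\<^bsub>B\<^esub> brace_upper_central B (n - Suc k)"
  proof (rule cover_star_set[OF star_power_subgroup star_in_star_power star_idealD(1)[OF ideal]
        R(1,2,4) star_idealD(2)[OF ideal] _ X gen star_idealD(2)[OF ideal]])
    show "b \<star> v \<in> brace_upper_central B (n - Suc k)"
      if "b \<in> carrier B" "v \<in> brace_upper_central B (n - k)" for b v
      using that(2)[unfolded step] that(1) by (rule star_upper_central(2))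
    show "z \<star> m \<in> brace_upper_central B (n - Suc k)"
      if "z \<in> brace_upper_central B n" "m \<in> star_power k" for z m
      using k that(1)[folded arg_cong[OF n_eq, of "brace_upper_central B"]] that(2) by (rule upper_central_star_star_power)
  qed
  then obtain R' where R': "finite R'" "R' \<subseteq> carrier B" "card R' \<le> card R ^ card X"
      "brace_star_set B (carrier B) (star_power k) \<subseteq> R' <+>\<^bsub>B\<^esub> brace_upper_central B (n - Suc k)"
    by blast
  have "card R' \<le> (?t ^ (card X ^ k)) ^ card X"
    using R'(3) power_mono[OF R(3) le0, of "card X"] by (rule order_trans)
  also have "\<dots> = ?t ^ (card X ^ Suc k)"
    unfolding power_mult[symmetric] power_Suc2 ..
  finally have bound: "card R' \<le> ?t ^ (card X ^ Suc k)" .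
  show ?case
    unfolding star_power.simps by (intro exI[of _ R'] conjI R'(1,2,4) bound)
qed

section \<open>The bound for the lower central series\<close>

text \<open>
  At the bottom of the upper central series the cosets are single points, so the cover of \<open>star_power n\<close>
  becomes a bound on its size. The alternative on \<open>n\<close> lets both claims of the theorem be instances.
\<close>

lemma lower_central_bound:
  assumes n: "n \<ge> 1" and case_n: "n = 1 \<or> derived_ideal B \<subseteq> brace_lambda_ker B"
    and fin: "finite (carrier (B Quot brace_upper_central B n))"
    and t: "card (carrier (B Quot brace_upper_central B n)) = t"
  shows "finite (brace_lower_central B (n + 1)) \<and>
    real (card (brace_lower_central B (n + 1))) \<le> omega (t\<^sup>2) ^ (t ^ (n - 1))"
proof -
  let ?Z = "brace_upper_central B n"
  have Z: "star_ideal ?Z" by (rule star_ideal_upper_central)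
  \<comment> \<open>For \<open>t = 1\<close> there is no prime divisor; any value above 1 then forces \<open>X\<close> to be empty.\<close>
  define p where "p = (if t > 1 then LEAST p. prime p \<and> p dvd t else 2)"
  have pleast: "p \<le> q" if "prime q" "q dvd t" for q
  proof (cases "t > 1")
    case True
    then show ?thesis using that by (auto simp: p_def intro: Least_le)
  qed (use that prime_ge_2_nat in \<open>auto simp: p_def\<close>)
  have p1: "p > 1"
  proof (cases "t > 1")
    case True
    then have "\<exists>p. prime p \<and> p dvd t" using prime_factor_nat[of t] by auto
    then have "prime p" using LeastI_ex[of "\<lambda>p. prime p \<and> p dvd t"] True by (simp add: p_def)
    then show ?thesis by (rule prime_gt_1_nat)
  qed (simp add: p_def)
  have carr: "carrier (B Mod ?Z) = carrier (B Quot ?Z)"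
    using star_ideal_cosets_eq[OF Z]
    by (auto simp: FactGroup_def FactRing_def A_RCOSETS_def RCOSETS_def a_r_coset_def)
  then have ord: "order (B Mod ?Z) = t" using t by (simp add: order_def)
  obtain X where X: "finite X" "X \<subseteq> carrier B" "p ^ card X \<le> t"
      and gen: "\<And>H. subgroup H B \<Longrightarrow> ?Z \<subseteq> H \<Longrightarrow> X \<subseteq> H \<Longrightarrow> H = carrier B"
    using exists_small_generating_set_mod[OF star_ideal_normal[OF Z], of p] fin pleast p1
    unfolding carr ord by blast
  obtain R where R: "finite R" "R \<subseteq> carrier B" "card R \<le> t ^ (card X ^ n)"
      "star_power n \<subseteq> R <+>\<^bsub>B\<^esub> brace_upper_central B (n - n)"
    using star_power_cover[OF case_n fin X(1,2) gen, of n] unfolding t by blast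
  have "R <+>\<^bsub>B\<^esub> {\<zero>} = R"
    using R(2) by (force simp: set_add_def')
  then have sub: "brace_lower_central B (n + 1) \<subseteq> R"
    using lower_central_subset_star_power[of n] case_n R(4) by auto
  have "real (card (brace_lower_central B (n + 1))) \<le> real (t ^ (card X ^ n))"
    using card_mono[OF R(1) sub] R(3) by (simp only: of_nat_le_iff)
  also have "\<dots> \<le> omega (t\<^sup>2) ^ (t ^ (n - 1))"
  proof (cases "t > 1")
    case True
    then show ?thesis using X(3) n by (intro omega_square_ge) (auto simp: p_def)
  next
    case False
    have "carrier (B Quot ?Z) \<noteq> {}"
      by (auto simp: FactRing_def A_RCOSETS_def RCOSETS_def)
    then have "t \<noteq> 0" using fin t by auto
    then have "t = 1" using False by simp
    then show ?thesis by (simp add: omega_def)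
  qed
  finally show ?thesis using finite_subset[OF sub R(1)] by simp
qed

end

theorem theorem4:
  fixes B :: "('a, 'm) ring_scheme"
  assumes "skew_brace_abelian_type B"
  shows "(\<forall>t. finite (carrier (B Quot brace_centre B)) \<and>
            card (carrier (B Quot brace_centre B)) = t \<longrightarrow>
              finite (derived_ideal B) \<and>
              real (card (derived_ideal B)) \<le> omega (t\<^sup>2)) \<and>
         (\<forall>n t. n \<ge> 1 \<and> derived_ideal B \<subseteq> brace_lambda_ker B \<and>
            finite (carrier (B Quot brace_upper_central B n)) \<and>
            card (carrier (B Quot brace_upper_central B n)) = t \<longrightarrow>
              finite (brace_lower_central B (n + 1)) \<and>
              real (card (brace_lower_central B (n + 1))) \<le> omega (t\<^sup>2) ^ (t ^ (n - 1)))"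
proof -
  interpret skew_brace_abelian_type B by (rule assms)
  have derived: "derived_ideal B = brace_lower_central B (1 + 1)" by simp
  show ?thesis
  proof (intro conjI allI impI)
    fix t assume "finite (carrier (B Quot brace_centre B)) \<and> card (carrier (B Quot brace_centre B)) = t"
    then have b: "finite (brace_lower_central B (1 + 1)) \<and>
        real (card (brace_lower_central B (1 + 1))) \<le> omega (t\<^sup>2) ^ (t ^ (1 - 1))"
      unfolding brace_centre_eq_upper_central by (intro lower_central_bound) auto
    show "finite (derived_ideal B)" using b by (simp only: derived)
    show "real (card (derived_ideal B)) \<le> omega (t\<^sup>2)" using b unfolding derived by simp
  next
    fix n t assume a: "n \<ge> 1 \<and> derived_ideal B \<subseteq> brace_lambda_ker B \<and>
            finite (carrier (B Quot brace_upper_central B n)) \<and>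
            card (carrier (B Quot brace_upper_central B n)) = t"
    then have b: "finite (brace_lower_central B (n + 1)) \<and>
      real (card (brace_lower_central B (n + 1))) \<le> omega (t\<^sup>2) ^ (t ^ (n - 1))"
      by (intro lower_central_bound) auto
    show "finite (brace_lower_central B (n + 1))" using b by blast
    show "real (card (brace_lower_central B (n + 1))) \<le> omega (t\<^sup>2) ^ (t ^ (n - 1))" using b by blast
  qed
qed

end
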